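(* Let $K$ be an infinite field. For every fixed $k \in \mathbb{N}$ there exists $d \in \mathbb{N}$ such that for all $p \in \mathbb{N}$ and all $n_1,\ldots,n_p \in \mathbb{N}$ the set of $n_1 \times \cdots \times n_p$-tensors over $K$ of border rank at most $k$ is defined by the vanishing of a number of polynomials of degree at most $d$; that is, it is the common zero set, in the space $K^{n_1 \times \cdots \times n_p}$ of all such tensors, of a collection of polynomials over $K$ in the $n_1\cdots n_p$ tensor entries, each of degree at most $d$.
   Context: An $n_1 \times \cdots \times n_p$-tensor $\omega$ over $K$ is a $p$-dimensional array of scalars in $K$ of these sizes. It is pure if there are vectors $x_1 \in K^{n_1},\ldots,x_p \in K^{n_p}$ with $\omega(i_1,\ldots,i_p)=x_1(i_1)\cdots x_p(i_p)$ for all indices. The rank of a tensor is the minimal number of terms in any expression of it as a sum of pure tensors. The border rank of $\omega$ is the minimal $k$ such that every polynomial in the tensor entries (with coefficients in $K$) that vanishes identically on the set of tensors of rank at most $k$ also vanishes on $\omega$; equivalently, $\omega$ has border rank at most $k$ if and only if it lies in the Zariski closure of the set of tensors of rank at most $k$. *)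

theory Defs
  imports Complex_Main "HOL-Library.Poly_Mapping" "HOL-Library.Extended_Nat" "HOL-Library.FuncSet"
begin

section \<open>Tensors\<close>

text \<open>
  A format \<open>n\<^sub>1 \<times> \<dots> \<times> n\<^sub>p\<close> is the list \<open>ns = [n\<^sub>1, \<dots>, n\<^sub>p]\<close> (so \<open>p = length ns\<close>), and positions
  in the array are lists of length \<open>p\<close>, with indices counted from 0. The case \<open>p = 0\<close> is allowed:
  there is then a single position \<open>[]\<close>, and the only pure tensor is the scalar 1 (empty product).
\<close>

definition tensor_positions :: "nat list \<Rightarrow> nat list set" where
  "tensor_positions ns = {is. length is = length ns \<and> (\<forall>j<length ns. is ! j < ns ! j)}"

text \<open>Extensional functions, so that a tensor is determined by its entries.\<close>

definition tensor_space :: "nat list \<Rightarrow> (nat list \<Rightarrow> 'k) set" where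
  "tensor_space ns = tensor_positions ns \<rightarrow>\<^sub>E UNIV"

text \<open>Only the values \<open>x j i\<close> with \<open>j < p\<close> and \<open>i < n\<^sub>j\<close> matter: \<open>x j\<close> stands for a vector in
  \<open>K\<^bsup>n\<^sub>j\<^esup>\<close>.\<close>

definition pure_tensor :: "nat list \<Rightarrow> (nat list \<Rightarrow> 'k::field) \<Rightarrow> bool" where
  "pure_tensor ns \<omega> \<longleftrightarrow> \<omega> \<in> tensor_space ns \<and>
     (\<exists>x :: nat \<Rightarrow> nat \<Rightarrow> 'k. \<forall>is\<in>tensor_positions ns. \<omega> is = (\<Prod>j<length ns. x j (is ! j)))"

definition sum_of_pure_tensors :: "nat list \<Rightarrow> nat \<Rightarrow> (nat list \<Rightarrow> 'k::field) \<Rightarrow> bool" where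
  "sum_of_pure_tensors ns r \<omega> \<longleftrightarrow>
     (\<exists>\<tau>. (\<forall>t<r. pure_tensor ns (\<tau> t)) \<and>
          (\<forall>is\<in>tensor_positions ns. \<omega> is = (\<Sum>t<r. \<tau> t is)))"

text \<open>The infimum in \<^typ>\<open>enat\<close> is the minimum, or \<open>\<infinity>\<close> if no such expression exists. The latter
  can only happen for \<open>p = 0\<close>.\<close>

definition tensor_rank :: "nat list \<Rightarrow> (nat list \<Rightarrow> 'k::field) \<Rightarrow> enat" where
  "tensor_rank ns \<omega> = Inf (enat ` {r. sum_of_pure_tensors ns r \<omega>})"

section \<open>Polynomials in the tensor entries\<close>

text \<open>
  A multivariate polynomial is a finitely supported map from monomials to coefficients, a monomial
  being a finitely supported map from variables to exponents. The variables are positions.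
\<close>

type_synonym ('v, 'k) mpolynomial = "('v \<Rightarrow>\<^sub>0 nat) \<Rightarrow>\<^sub>0 'k"

definition mpoly_eval :: "('v, 'k) mpolynomial \<Rightarrow> ('v \<Rightarrow> 'k) \<Rightarrow> 'k::comm_semiring_1" where
  "mpoly_eval f a =
     (\<Sum>m\<in>Poly_Mapping.keys f. Poly_Mapping.lookup f m *
        (\<Prod>v\<in>Poly_Mapping.keys m. a v ^ Poly_Mapping.lookup m v))"

definition mpoly_degree :: "('v, 'k::zero) mpolynomial \<Rightarrow> nat" where
  "mpoly_degree f =
     Max (insert 0 ((\<lambda>m. \<Sum>v\<in>Poly_Mapping.keys m. Poly_Mapping.lookup m v) ` Poly_Mapping.keys f))"

definition tensor_polys :: "nat list \<Rightarrow> (nat list, 'k::zero) mpolynomial set" where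
  "tensor_polys ns = {f. \<forall>m\<in>Poly_Mapping.keys f. Poly_Mapping.keys m \<subseteq> tensor_positions ns}"

section \<open>Border rank\<close>

definition border_rank :: "nat list \<Rightarrow> (nat list \<Rightarrow> 'k::field) \<Rightarrow> enat" where
  "border_rank ns \<omega> = Inf (enat ` {k.
     \<forall>f\<in>tensor_polys ns.
       (\<forall>\<tau>\<in>tensor_space ns. tensor_rank ns \<tau> \<le> enat k \<longrightarrow> mpoly_eval f \<tau> = 0) \<longrightarrow>
       mpoly_eval f \<omega> = 0})"

end

theory Submission
  imports Defs "HOL-Library.Sublist" "HOL-Library.Countable"
    "HOL-Computational_Algebra.Polynomial" "Jordan_Normal_Form.Determinant"
begin

text \<open>
  Let \<open>X\<^sub>d(ns)\<close> be the common zero set of all polynomials of degree at most \<open>d\<close> that vanish on the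
  tensors of format \<open>ns\<close> and rank at most \<open>k\<close>. The sets \<open>X\<^sub>d(ns)\<close> decrease with \<open>d\<close>, and their
  intersection is the set of tensors of border rank at most \<open>k\<close>; the claim is that for some \<open>d\<close> they
  have become constant for all formats simultaneously. The only information that links different
  formats is this: a linear map between tensor spaces that sends pure tensors to pure tensors does not
  increase the rank, and composing a polynomial with a linear map does not raise the degree. Hence
  such \<^emph>\<open>natural\<close> maps carry \<open>X\<^sub>d(ns)\<close> into \<open>X\<^sub>d(ns')\<close>.

  If no \<open>d\<close> works, there are tensors \<open>T\<^sub>0, T\<^sub>1, \<dots>\<close> of varying formats \<open>ns\<^sub>i\<close> and polynomials
  \<open>g\<^sub>i\<close> that vanish in rank at most \<open>k\<close> such that \<open>g\<^sub>i(T\<^sub>i) \<noteq> 0\<close>, while \<open>g\<^sub>i\<close> vanishes on every image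
  of a later \<open>T\<^sub>j\<close> under a natural map into format \<open>ns\<^sub>i\<close>. Moreover all \<open>T\<^sub>i\<close> may be taken in
  \<open>X\<^bsub>k+1\<^esub>\<close>, so that every flattening of \<open>T\<^sub>i\<close>, being subject to the determinants of size \<open>k + 1\<close>,
  has rank at most \<open>k\<close>. The contradiction comes from a parametrisation that is uniform in the number
  of factors (\<open>matrix_product_form\<close>). View \<open>T\<close> as a multilinear form \<open>F(y\<^sub>1, \<dots>, y\<^sub>p)\<close>. Outside a set
  of at most \<open>2k\<close> positions, called the head, \<open>F\<close> is a product of matrices \<open>X\<^sub>a(y\<^sub>a)\<close> of size
  \<open>r \<le> k\<close>, one for each position \<open>a\<close>, sandwiched between factors that depend on the head only; and
  for each such \<open>a\<close> there is a vector \<open>l\<^sub>a\<close> for which \<open>X\<^sub>a(l\<^sub>a)\<close> is the identity. Contracting \<open>T\<close> with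
  \<open>l\<^sub>a\<close> at position \<open>a\<close>, a natural operation, therefore just deletes the matrix \<open>X\<^sub>a\<close> from the product.

  Each factor of the format can be replaced by \<open>K\<^sup>k\<close>, again by natural maps
  (\<open>small_format_expansion\<close>). After that, for \<open>i\<close> in an infinite set on which the sizes of head and matrices are
  constant, \<open>T\<^sub>i\<close> is described by a word whose letters are points of one affine space: a letter lists
  the entries of \<open>X\<^sub>a\<close> on the basis of \<open>K\<^sup>k\<close>, together with the head data. Subwords of the word of \<open>T\<^sub>j\<close> of the right length describe images of \<open>T\<^sub>j\<close> under
  natural maps. So \<open>g\<^sub>i\<close> becomes a polynomial in the letters that does not vanish on the word of
  \<open>T\<^sub>i\<close> but vanishes on all subwords, of the same length, of the words of all later \<open>T\<^sub>j\<close>. Such a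
  sequence does not exist: this is the theorem of Cohen that the polynomial ring in the entries of an
  infinitely wide matrix is Noetherian up to strictly increasing maps of the columns
  (\<open>wide_matrix_noetherian\<close>), which follows from Higman's lemma by cancelling leading terms.
\<close>

section \<open>The lemmas of Dickson and Higman\<close>

text \<open>
  Nash-Williams's minimal bad sequence. Among the sequences without an embedded pair take one that is
  minimal in length term by term. Its terms are nonempty; removing the first letters along a
  subsequence on which these letters increase gives a smaller sequence, still without a pair.
\<close>

lemma higman:
  fixes P :: "'a \<Rightarrow> 'a \<Rightarrow> bool" and s :: "nat \<Rightarrow> 'a list"
  assumes asc: "\<And>f. (\<And>i. f i \<in> A) \<Longrightarrow>
      \<exists>\<phi> :: nat \<Rightarrow> nat. strict_mono \<phi> \<and> (\<forall>i j. i < j \<longrightarrow> P (f (\<phi> i)) (f (\<phi> j)))"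
    and s: "\<And>i. set (s i) \<subseteq> A"
  shows "\<exists>i j. i < j \<and> list_emb P (s i) (s j)"
proof (rule ccontr)
  assume no_pair: "\<not> ?thesis"
  define bad where "bad z \<longleftrightarrow> (\<forall>i. set (z i) \<subseteq> A) \<and>
      (\<forall>i j. i < j \<longrightarrow> \<not> list_emb P (z i) (z j))" for z :: "nat \<Rightarrow> 'a list"
  have bad_s: "bad s"
    using s no_pair by (auto simp: bad_def)
  \<comment> \<open>\<open>S (n + 1)\<close> agrees with \<open>S n\<close> before \<open>n\<close> and has the shortest possible term at \<open>n\<close>; the diagonal
    is the minimal sequence.\<close>
  have "\<exists>S. \<forall>n. bad (S n) \<and> ((\<forall>i<n. S (Suc n) i = S n i) \<and>
      (\<forall>z. bad z \<longrightarrow> (\<forall>i<n. z i = S n i) \<longrightarrow> length (S (Suc n) n) \<le> length (z n)))"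
  proof (rule dependent_nat_choice)
    show "\<exists>x. bad x" using bad_s by blast
  next
    fix x and n :: nat
    assume "bad x"
    then show "\<exists>y. bad y \<and> ((\<forall>i<n. y i = x i) \<and>
        (\<forall>z. bad z \<longrightarrow> (\<forall>i<n. z i = x i) \<longrightarrow> length (y n) \<le> length (z n)))"
      using ex_has_least_nat[of "\<lambda>y. bad y \<and> (\<forall>i<n. y i = x i)" x "\<lambda>y. length (y n)"] by auto
  qed
  then obtain S where bad_S: "\<And>n. bad (S n)"
    and S_step: "\<And>n i. i < n \<Longrightarrow> S (Suc n) i = S n i"
    and S_min: "\<And>n z. bad z \<Longrightarrow> (\<And>i. i < n \<Longrightarrow> z i = S n i) \<Longrightarrow> length (S (Suc n) n) \<le> length (z n)"
    by blast
  define m where "m n = S (Suc n) n" for n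
  have agree: "S n i = m i" if "i < n" for i n
    using that
  proof (induction n)
    case (Suc n)
    then show ?case
      using S_step[of i n] by (cases "i = n") (simp_all add: m_def)
  qed simp
  have m_min: "length (m n) \<le> length (z n)" if "bad z" "\<And>i. i < n \<Longrightarrow> z i = m i" for z n
  proof -
    have "z i = S n i" if "i < n" for i
      using \<open>i < n \<Longrightarrow> z i = m i\<close> agree that by simp
    then show ?thesis
      using S_min[OF that(1), of n] unfolding m_def by blast
  qed
  have m_A: "set (m i) \<subseteq> A" for i
    using bad_S[of "Suc i"] by (auto simp: bad_def m_def)
  have m_bad: "\<not> list_emb P (m i) (m j)" if "i < j" for i j
  proof -
    have "S (Suc j) i = m i" "S (Suc j) j = m j"
      using that by (simp_all add: agree)
    then show ?thesis
      using bad_S[of "Suc j"] that unfolding bad_def by metis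
  qed
  have m_ne: "m n \<noteq> []" for n
    using m_bad[of n "Suc n"] by auto
  have hd_A: "hd (m n) \<in> A" for n
    using hd_in_set[OF m_ne[of n]] m_A[of n] by (rule rev_subsetD)
  obtain \<phi> :: "nat \<Rightarrow> nat" where \<phi>_hds: "strict_mono \<phi> \<and>
      (\<forall>i j. i < j \<longrightarrow> P (hd (m (\<phi> i))) (hd (m (\<phi> j))))"
    using asc[of "\<lambda>n. hd (m n)", OF hd_A] by (rule exE)
  then have \<phi>: "strict_mono \<phi>"
    and hds: "\<And>i j. i < j \<Longrightarrow> P (hd (m (\<phi> i))) (hd (m (\<phi> j)))"
    by simp_all
  \<comment> \<open>The initial segment is kept, so that minimality at the index \<open>\<phi> 0\<close> applies to \<open>z\<close>.\<close>
  define z where "z n = (if n < \<phi> 0 then m n else tl (m (\<phi> (n - \<phi> 0))))" for n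
  have "\<not> list_emb P (z i) (z j)" if ij: "i < j" for i j
  proof (cases "j < \<phi> 0")
    case True
    then show ?thesis using ij m_bad by (auto simp: z_def)
  next
    case j: False
    let ?j = "\<phi> (j - \<phi> 0)"
    have mj: "m ?j = hd (m ?j) # tl (m ?j)"
      using m_ne by simp
    have zj: "z j = tl (m ?j)"
      using j by (simp add: z_def)
    show ?thesis
    proof (cases "i < \<phi> 0")
      case True
      then have "i < ?j"
        using \<phi> by (meson le0 less_le_trans strict_mono_less_eq)
      then have "\<not> list_emb P (m i) (m ?j)" by (rule m_bad)
      then have "\<not> list_emb P (m i) (tl (m ?j))"
        using mj by (metis list_emb_Cons)
      then show ?thesis using True zj by (simp add: z_def)
    next
      case i: False
      let ?i = "\<phi> (i - \<phi> 0)"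
      have lt: "i - \<phi> 0 < j - \<phi> 0"
        using i j ij by linarith
      then have "?i < ?j"
        using \<phi> by (simp add: strict_mono_less)
      then have "\<not> list_emb P (m ?i) (m ?j)" by (rule m_bad)
      moreover have "P (hd (m ?i)) (hd (m ?j))"
        using hds lt by blast
      moreover have "m ?i = hd (m ?i) # tl (m ?i)"
        using m_ne by simp
      ultimately have "\<not> list_emb P (tl (m ?i)) (tl (m ?j))"
        using mj by (metis list_emb_Cons2)
      then show ?thesis using i zj by (simp add: z_def)
    qed
  qed
  moreover have "set (z i) \<subseteq> A" for i
    using m_A[of i] m_A[of "\<phi> (i - \<phi> 0)"] m_ne[of "\<phi> (i - \<phi> 0)"]
    by (auto simp: z_def dest: list.set_sel(2))
  ultimately have "bad z"
    by (auto simp: bad_def)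
  then have "length (m (\<phi> 0)) \<le> length (z (\<phi> 0))"
    by (rule m_min) (simp add: z_def)
  then show False
    using m_ne[of "\<phi> 0"] by (cases "m (\<phi> 0)") (simp_all add: z_def)
qed

lemma nat_sequence_mono_subsequence:
  fixes f :: "nat \<Rightarrow> nat"
  shows "\<exists>\<phi> :: nat \<Rightarrow> nat. strict_mono \<phi> \<and> (\<forall>i j. i < j \<longrightarrow> f (\<phi> i) \<le> f (\<phi> j))"
proof -
  obtain \<phi> where \<phi>: "strict_mono \<phi>" "monoseq (\<lambda>n. f (\<phi> n))"
    using seq_monosub by blast
  show ?thesis
  proof (cases "incseq (\<lambda>n. f (\<phi> n))")
    case True
    then show ?thesis using \<phi>(1) by (auto simp: incseq_def)
  next
    case False
    then have dec: "decseq (\<lambda>n. f (\<phi> n))"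
      using \<phi>(2) by (simp add: monoseq_iff)
    obtain n0 where n0: "\<And>n. f (\<phi> n0) \<le> f (\<phi> n)"
      using ex_has_least_nat[of "\<lambda>_. True" 0 "\<lambda>n. f (\<phi> n)"] by auto
    have "f (\<phi> (n0 + n)) = f (\<phi> n0)" for n
      using n0[of "n0 + n"] decseqD[OF dec, of n0 "n0 + n"] by simp
    then show ?thesis
      using \<phi>(1) by (intro exI[of _ "\<lambda>n. \<phi> (n0 + n)"]) (auto simp: strict_mono_def)
  qed
qed

text \<open>
  Stated for subsequences rather than for pairs, since this is the form in which it survives the
  passage from one coordinate to the next, and the form in which Higman's lemma uses it.
\<close>

lemma dickson:
  fixes f :: "nat \<Rightarrow> nat list"
  assumes "\<And>i. length (f i) = M"
  shows "\<exists>\<phi> :: nat \<Rightarrow> nat. strict_mono \<phi> \<and>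
    (\<forall>i j. i < j \<longrightarrow> list_all2 (\<le>) (f (\<phi> i)) (f (\<phi> j)))"
  using assms
proof (induction M arbitrary: f)
  case 0
  then show ?case by (intro exI[of _ id]) (auto simp: strict_mono_def)
next
  case (Suc M)
  obtain \<phi> :: "nat \<Rightarrow> nat" where \<phi>: "strict_mono \<phi>"
    "\<And>i j. i < j \<Longrightarrow> hd (f (\<phi> i)) \<le> hd (f (\<phi> j))"
    using nat_sequence_mono_subsequence[of "\<lambda>i. hd (f i)"] by blast
  have "length (tl (f (\<phi> i))) = M" for i
    using Suc.prems by simp
  from Suc.IH[of "\<lambda>i. tl (f (\<phi> i))", OF this] obtain \<psi> :: "nat \<Rightarrow> nat" where \<psi>: "strict_mono \<psi>"
    "\<And>i j. i < j \<Longrightarrow> list_all2 (\<le>) (tl (f (\<phi> (\<psi> i)))) (tl (f (\<phi> (\<psi> j))))"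
    by blast
  have "list_all2 (\<le>) (f (\<phi> (\<psi> i))) (f (\<phi> (\<psi> j)))" if "i < j" for i j
  proof -
    have ne: "f n \<noteq> []" for n
      using Suc.prems[of n] by auto
    have "list_all2 (\<le>) (hd (f (\<phi> (\<psi> i))) # tl (f (\<phi> (\<psi> i)))) (hd (f (\<phi> (\<psi> j))) # tl (f (\<phi> (\<psi> j))))"
      using \<psi> that \<phi>(2)[of "\<psi> i" "\<psi> j"] by (simp add: strict_mono_less)
    then show ?thesis using ne by simp
  qed
  then show ?case
    using \<phi>(1) \<psi>(1) by (intro exI[of _ "\<phi> \<circ> \<psi>"]) (auto simp: strict_mono_def)
qed

section \<open>Noetherianity for wide matrices\<close>

text \<open>
  The linear span of a set of functions, built one term at a time: the induction rule then follows the
  terms of a polynomial, for polynomials in tensor entries and in letters alike.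
\<close>

inductive_set fspan :: "('a \<Rightarrow> 'k::comm_ring_1) set \<Rightarrow> ('a \<Rightarrow> 'k) set"
  for B :: "('a \<Rightarrow> 'k) set" where
  zero: "(\<lambda>_. 0) \<in> fspan B"
| step: "b \<in> B \<Longrightarrow> g \<in> fspan B \<Longrightarrow> (\<lambda>a. c * b a + g a) \<in> fspan B"

lemma fspan_base: "b \<in> B \<Longrightarrow> b \<in> fspan B"
  using fspan.step[OF _ fspan.zero, of b B 1] by simp

lemma fspan_add: "f \<in> fspan B \<Longrightarrow> g \<in> fspan B \<Longrightarrow> (\<lambda>a. f a + g a) \<in> fspan B"
proof (induction rule: fspan.induct)
  case (step b f c)
  then show ?case
    using fspan.step[of b B "\<lambda>a. f a + g a" c] by (simp add: add.assoc)
qed simp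

lemma fspan_scale: "g \<in> fspan B \<Longrightarrow> (\<lambda>a. c * g a) \<in> fspan B"
proof (induction rule: fspan.induct)
  case zero
  then show ?case by (simp add: fspan.zero)
next
  case (step b g c')
  then show ?case
    using fspan.step[of b B "\<lambda>a. c * g a" "c * c'"] by (simp add: algebra_simps)
qed

lemma fspan_sum: "(\<And>i. i \<in> I \<Longrightarrow> f i \<in> fspan B) \<Longrightarrow> (\<lambda>a. \<Sum>i\<in>I. f i a) \<in> fspan B"
  by (induction I rule: infinite_finite_induct) (auto intro: fspan.zero fspan_add)

text \<open>
  Multiplication by a fixed function and substitution are linear, so it suffices to know them on
  generators.
\<close>

lemma fspan_transform:
  assumes "g \<in> fspan B" and "\<And>b. b \<in> B \<Longrightarrow> (\<lambda>a. p a * b (s a)) \<in> fspan C"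
  shows "(\<lambda>a. p a * g (s a)) \<in> fspan C"
  using assms(1)
proof (induction rule: fspan.induct)
  case zero
  then show ?case by (simp add: fspan.zero)
next
  case (step b g c)
  then show ?case
    using fspan_add[OF fspan_scale[OF assms(2)[of b], of c] step.IH] by (simp add: algebra_simps)
qed

lemma fspan_subset: "g \<in> fspan B \<Longrightarrow> B \<subseteq> fspan C \<Longrightarrow> g \<in> fspan C"
  using fspan_transform[of g B "\<lambda>_. 1" "\<lambda>a. a" C] by auto

lemma fspan_mult:
  assumes "f \<in> fspan B" "g \<in> fspan C"
    and "\<And>b c. b \<in> B \<Longrightarrow> c \<in> C \<Longrightarrow> (\<lambda>a. b a * c a) \<in> fspan D"
  shows "(\<lambda>a. f a * g a) \<in> fspan D"
proof -
  have "(\<lambda>a. c a * f a) \<in> fspan D" if "c \<in> C" for c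
    using fspan_transform[OF assms(1), of c "\<lambda>a. a"] assms(3) that by (simp add: mult.commute)
  then show ?thesis
    using fspan_transform[OF assms(2), of f "\<lambda>a. a"] by (simp add: mult.commute)
qed

text \<open>
  A letter is a point of affine space with coordinates indexed by natural numbers; an exponent vector
  is a list, and only the coordinates within its length occur.
\<close>

definition letter_monom :: "nat list \<Rightarrow> (nat \<Rightarrow> 'k::comm_ring_1) \<Rightarrow> 'k" where
  "letter_monom e x = (\<Prod>m<length e. x m ^ (e ! m))"

text \<open>
  The value 0 for words of the wrong length makes identities between monomials hold for all arguments,
  so that functions, and not just their restrictions to words of the right length, can be compared.
\<close>

fun word_monom :: "nat list list \<Rightarrow> (nat \<Rightarrow> 'k::comm_ring_1) list \<Rightarrow> 'k" where
  "word_monom [] [] = 1"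
| "word_monom (e # u) (x # xs) = letter_monom e x * word_monom u xs"
| "word_monom _ _ = 0"

text \<open>
  Monomials in \<open>q\<close> letters with \<open>M\<close> coordinates each.
\<close>

definition shape :: "nat \<Rightarrow> nat \<Rightarrow> nat list list \<Rightarrow> bool" where
  "shape M q u \<longleftrightarrow> length u = q \<and> (\<forall>e\<in>set u. length e = M)"

lemma shape_Nil [simp]: "shape M q [] \<longleftrightarrow> q = 0"
  and shape_Cons [simp]: "shape M q (e # u) \<longleftrightarrow> length e = M \<and> (\<exists>q'. q = Suc q' \<and> shape M q' u)"
  by (auto simp: shape_def)

lemma shape_length: "shape M q u \<Longrightarrow> length u = q"
  by (simp add: shape_def)

lemma letter_monom_add:
  "length d = length e \<Longrightarrow> letter_monom (map2 (+) d e) x = letter_monom d x * letter_monom e x"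
  by (simp add: letter_monom_def power_add prod.distrib)

text \<open>
  A monomial order: well-founded, total, and lexicographic in the letters, hence respected by
  multiplication and by inserting letters at fixed places.
\<close>

abbreviation word_order :: "(nat list list \<times> nat list list) set" where
  "word_order \<equiv> lenlex (lenlex less_than)"

lemma letter_order_add:
  "length d = length x \<Longrightarrow> length e = length x \<Longrightarrow> (e, x) \<in> lenlex less_than \<Longrightarrow>
    (map2 (+) d e, map2 (+) d x) \<in> lenlex less_than"
proof (induction d arbitrary: e x)
  case (Cons n d)
  then show ?case by (cases e; cases x) (auto simp: Cons_lenlex_iff)
qed simp

lemma list_diff_add:
  "list_all2 (\<le>) (x :: nat list) y \<Longrightarrow> map2 (+) (map2 (-) y x) x = y"
  by (induction rule: list_all2_induct) auto

text \<open>
  If \<open>u\<close> embeds into \<open>v\<close>, then \<open>v\<close> is a multiple of a copy of \<open>u\<close>. Choosing the places of the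
  embedding gives a selection \<open>sel\<close> of letters, and \<open>w\<close> is the cofactor: the map \<open>Z\<close> sends the
  monomial \<open>u'\<close> to \<open>w\<close> times \<open>u'\<close> in the selected letters. It takes \<open>u\<close> to \<open>v\<close> and
  monomials below \<open>u\<close> to monomials below \<open>v\<close>, so that a polynomial with leading monomial \<open>u\<close>
  goes to one with leading monomial \<open>v\<close>.
\<close>

lemma word_embedding:
  assumes "list_emb (list_all2 (\<le>)) u v" "shape M p u" "shape M q v"
  shows "\<exists>sel w Z.
     (\<forall>a :: (nat \<Rightarrow> 'k::comm_ring_1) list. length a = q \<longrightarrow> subseq (sel a) a \<and> length (sel a) = p) \<and>
     (\<forall>u'. shape M p u' \<longrightarrow> shape M q (Z u') \<and>
        (\<forall>a. word_monom w a * word_monom u' (sel a) = word_monom (Z u') a)) \<and>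
     Z u = v \<and> (\<forall>u'. shape M p u' \<longrightarrow> (u', u) \<in> word_order \<longrightarrow> (Z u', v) \<in> word_order)"
  using assms
proof (induction arbitrary: p q rule: list_emb.induct)
  case (list_emb_Nil ys)
  then show ?case
    by (intro exI[of _ "\<lambda>_. []"] exI[of _ ys] exI[of _ "\<lambda>_. ys"]) (auto simp: shape_def)
next
  case (list_emb_Cons xs ys y)
  then obtain q' where q: "q = Suc q'" "shape M q' ys" "length y = M"
    by auto
  from list_emb_Cons.IH[OF list_emb_Cons.prems(1) q(2)] obtain sel w Z where
    sel: "\<And>a :: (nat \<Rightarrow> 'k) list. length a = q' \<Longrightarrow> subseq (sel a) a \<and> length (sel a) = p"
    and Z: "\<And>u'. shape M p u' \<Longrightarrow> shape M q' (Z u')"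
    and mon: "\<And>u' a. shape M p u' \<Longrightarrow> word_monom w a * word_monom u' (sel a) = word_monom (Z u') a"
    and Z_eq: "Z xs = ys"
    and ord: "\<And>u'. shape M p u' \<Longrightarrow> (u', xs) \<in> word_order \<Longrightarrow> (Z u', ys) \<in> word_order"
    by blast
  have 1: "subseq (sel (tl a)) a \<and> length (sel (tl a)) = p" if "length a = q" for a
    using that q sel[of "tl a"] by (cases a) auto
  have 2: "shape M q (y # Z u')" if "shape M p u'" for u'
    using Z that q by auto
  have 3: "word_monom (y # w) a * word_monom u' (sel (tl a)) = word_monom (y # Z u') a"
    if "shape M p u'" for a u'
    using mon[OF that] by (cases a) (simp_all add: mult.assoc)
  have 4: "(y # Z u', y # ys) \<in> word_order" if "shape M p u'" "(u', xs) \<in> word_order" for u'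
    using ord[OF that] Z[OF that(1)] shape_length[OF q(2)] shape_length[OF Z[OF that(1)]]
    by (simp add: Cons_lenlex_iff)
  show ?case
    using 1 2 3 4 Z_eq
    by (intro exI[of _ "\<lambda>a. sel (tl a)"] exI[of _ "y # w"] exI[of _ "\<lambda>u'. y # Z u'"]) auto
next
  case (list_emb_Cons2 x y xs ys)
  then obtain p' q' where q: "q = Suc q'" "shape M q' ys" "length y = M"
     and p: "p = Suc p'" "shape M p' xs" "length x = M"
    by auto
  from list_emb_Cons2.IH[OF p(2) q(2)] obtain sel w Z where
    sel: "\<And>a :: (nat \<Rightarrow> 'k) list. length a = q' \<Longrightarrow> subseq (sel a) a \<and> length (sel a) = p'"
    and Z: "\<And>u'. shape M p' u' \<Longrightarrow> shape M q' (Z u')"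
    and mon: "\<And>u' a. shape M p' u' \<Longrightarrow> word_monom w a * word_monom u' (sel a) = word_monom (Z u') a"
    and Z_eq: "Z xs = ys"
    and ord: "\<And>u'. shape M p' u' \<Longrightarrow> (u', xs) \<in> word_order \<Longrightarrow> (Z u', ys) \<in> word_order"
    by blast
  define d where "d = map2 (-) y x"
  have d: "length d = M" "map2 (+) d x = y"
    using list_emb_Cons2.hyps p q by (simp_all add: d_def list_diff_add)
  let ?Z = "\<lambda>u'. map2 (+) d (hd u') # Z (tl u')"
  let ?sel = "\<lambda>a. hd a # sel (tl a)"
  have 1: "subseq (?sel a) a \<and> length (?sel a) = p" if "length a = q" for a
    using that q p sel[of "tl a"] by (cases a) auto
  have 2: "shape M q (?Z u')" if "shape M p u'" for u'
    using Z that q p d by (cases u') auto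
  have 3: "word_monom (d # w) a * word_monom u' (?sel a) = word_monom (?Z u') a"
    if "shape M p u'" for a u'
    using mon that p d by (cases a; cases u') (simp_all add: letter_monom_add ac_simps)
  have 4: "(?Z u', y # ys) \<in> word_order" if shp: "shape M p u'" and lt: "(u', x # xs) \<in> word_order" for u'
  proof -
    obtain e u0 where u': "u' = e # u0" "length e = M" "shape M p' u0"
      using shp p by (cases u') auto
    have len: "length u0 = length xs" "length (Z u0) = length ys"
      using u' p q shape_length Z by metis+
    then have "(e, x) \<in> lenlex less_than \<or> e = x \<and> (u0, xs) \<in> word_order"
      using lt u' by (simp add: Cons_lenlex_iff)
    then show ?thesis
    proof
      assume "(e, x) \<in> lenlex less_than"
      then have "(map2 (+) d e, map2 (+) d x) \<in> lenlex less_than"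
        using letter_order_add[of d x e] d p u' by metis
      then show ?thesis using len u' d by (simp add: Cons_lenlex_iff)
    next
      assume "e = x \<and> (u0, xs) \<in> word_order"
      then show ?thesis using ord u' len d by (simp add: Cons_lenlex_iff)
    qed
  qed
  have 5: "?Z (x # xs) = y # ys"
    using d Z_eq by simp
  show ?case
    using 1 2 3 4 5
    by (intro exI[of _ ?sel] exI[of _ "d # w"] exI[of _ ?Z]) blast
qed

definition lower_span :: "nat \<Rightarrow> nat list list \<Rightarrow> ((nat \<Rightarrow> 'k::comm_ring_1) list \<Rightarrow> 'k) set" where
  "lower_span M v = fspan (word_monom ` {u. shape M (length v) u \<and> (u, v) \<in> word_order})"

text \<open>
  Every nonzero polynomial has a leading monomial. The coefficient \<open>c\<close> may be zero, because the
  representation by terms need not be reduced; this does no harm to arguments by minimality of \<open>u\<close>.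
\<close>

lemma leading_word:
  assumes "g \<in> fspan (word_monom ` A)" and "\<And>u. u \<in> A \<Longrightarrow> shape M q u"
  shows "g = (\<lambda>_. 0) \<or> (\<exists>u\<in>A. \<exists>c. \<exists>l\<in>lower_span M u. g = (\<lambda>a. c * word_monom u a + l a))"
  using assms(1)
proof (induction rule: fspan.induct)
  case (step b g c)
  then obtain u1 where u1: "b = word_monom u1" "u1 \<in> A"
    by auto
  from step.IH show ?case
  proof
    assume "g = (\<lambda>_. 0)"
    then show ?thesis
      using u1 fspan.zero by (fastforce simp: lower_span_def)
  next
    assume "\<exists>u\<in>A. \<exists>c. \<exists>l\<in>lower_span M u. g = (\<lambda>a. c * word_monom u a + l a)"
    then obtain u2 c2 l where u2: "u2 \<in> A" "l \<in> lower_span M u2"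
      "g = (\<lambda>a. c2 * word_monom u2 a + l a)"
      by blast
    have len: "length u1 = q" "length u2 = q"
      using assms(2) u1 u2 by (auto simp: shape_def)
    have "total word_order"
      by (intro total_lenlex total_less_than)
    then consider "u1 = u2" | "(u1, u2) \<in> word_order" | "(u2, u1) \<in> word_order"
      by (auto simp: total_on_def)
    then show ?thesis
    proof cases
      case 1
      then have "(\<lambda>a. c * b a + g a) = (\<lambda>a. (c + c2) * word_monom u2 a + l a)"
        using u1 u2 by (auto simp: algebra_simps)
      then show ?thesis using u2 by blast
    next
      case 2
      then have low: "(\<lambda>a. c * word_monom u1 a + l a) \<in> lower_span M u2"
        using u2 len assms(2)[OF u1(2)] unfolding lower_span_def by (intro fspan.step) auto
      have "(\<lambda>a. c * b a + g a) =
          (\<lambda>a. c2 * word_monom u2 a + (c * word_monom u1 a + l a))"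
        using u1 u2 by (auto simp: algebra_simps)
      then show ?thesis using low u2(1) by (intro disjI2 bexI[of _ u2] exI[of _ c2] bexI[OF _ low])
    next
      case 3
      have "trans word_order"
        by (intro lenlex_transI trans_less_than)
      then have "{u. shape M (length u2) u \<and> (u, u2) \<in> word_order} \<subseteq>
          {u. shape M (length u1) u \<and> (u, u1) \<in> word_order}"
        using 3 len by (auto dest: transD)
      then have "l \<in> lower_span M u1"
        using u2(2) unfolding lower_span_def
        by (intro fspan_subset[OF u2(2)[unfolded lower_span_def]]) (auto intro: fspan_base)
      then have "g \<in> lower_span M u1"
        using 3 u2 len assms(2)[OF u2(1)] unfolding u2(3) lower_span_def
        by (intro fspan.step) auto
      then show ?thesis using u1 by blast
    qed
  qed
qed simp

text \<open>
  Consider the ideals \<open>I\<^sub>i\<close> of polynomials that vanish on all subwords of the \<open>a\<^sub>j\<close> with \<open>j \<ge> i\<close>. They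
  increase with \<open>i\<close>, and if the conclusion failed, \<open>g\<^sub>i\<close> would lie in \<open>I\<^bsub>i+1\<^esub>\<close> but not in \<open>I\<^sub>i\<close>. For each
  \<open>i\<close> choose \<open>G\<^sub>i\<close> in the union of all ideals, outside \<open>I\<^sub>i\<close>, with the least possible leading monomial. By
  Higman's lemma there are \<open>i\<close> and a much later \<open>j\<close> such that the leading monomial of \<open>G\<^sub>i\<close> embeds into
  that of \<open>G\<^sub>j\<close>. Subtracting a multiple of a copy of \<open>G\<^sub>i\<close>, which lies in \<open>I\<^sub>j\<close>, cancels the leading term
  of \<open>G\<^sub>j\<close> and contradicts its minimality.
\<close>

theorem wide_matrix_noetherian:
  fixes a :: "nat \<Rightarrow> (nat \<Rightarrow> 'k::field) list"
  assumes g: "\<And>i. g i \<in> fspan (word_monom ` {u. shape M (length (a i)) u})"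
    and nz: "\<And>i. g i (a i) \<noteq> 0"
  shows "\<exists>i j b. i < j \<and> subseq b (a j) \<and> length b = length (a i) \<and> g i b \<noteq> 0"
proof (rule ccontr)
  assume contra: "\<not> ?thesis"
  \<comment> \<open>\<open>van i q h\<close> says that \<open>h\<close>, a polynomial in \<open>q\<close> letters, lies in the \<open>i\<close>-th ideal.\<close>
  define van where "van i q h \<longleftrightarrow> (\<forall>j\<ge>i. \<forall>b. subseq b (a j) \<longrightarrow> length b = q \<longrightarrow> h b = 0)"
    for i q and h :: "(nat \<Rightarrow> 'k) list \<Rightarrow> 'k"
  define cand where "cand i v c l \<longleftrightarrow> shape M (length v) v \<and> l \<in> lower_span M v \<and>
      (\<exists>N. van N (length v) (\<lambda>b. c * word_monom v b + l b)) \<and>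
      \<not> van i (length v) (\<lambda>b. c * word_monom v b + l b)" for i v c and l :: "(nat \<Rightarrow> 'k) list \<Rightarrow> 'k"
  have "\<exists>v c l. cand i v c l \<and> (\<forall>u c' l'. cand i u c' l' \<longrightarrow> (u, v) \<notin> word_order)" for i
  proof -
    have not_van: "\<not> van i (length (a i)) (g i)"
    proof
      assume "van i (length (a i)) (g i)"
      then have "g i (a i) = 0" unfolding van_def by blast
      then show False using nz by simp
    qed
    have van: "van (Suc i) (length (a i)) (g i)"
      unfolding van_def using contra Suc_le_lessD by blast
    have "g i \<noteq> (\<lambda>_. 0)"
      using nz[of i] by auto
    then obtain v c l where v: "shape M (length (a i)) v" "l \<in> lower_span M v"
      "g i = (\<lambda>b. c * word_monom v b + l b)"
      using leading_word[OF g[of i], of M "length (a i)"] by blast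
    then have "cand i v c l"
      using not_van van shape_length[OF v(1)] unfolding cand_def by metis
    then have v_in: "v \<in> {v. \<exists>c l. cand i v c l}"
      by blast
    have wf: "wf word_order"
      by (intro wf_lenlex wf_less_than)
    obtain z where "z \<in> {v. \<exists>c l. cand i v c l}"
      "\<And>u. (u, z) \<in> word_order \<Longrightarrow> u \<notin> {v. \<exists>c l. cand i v c l}"
      by (rule wfE_min[OF wf v_in]) blast
    then show ?thesis by blast
  qed
  then obtain v c l where cand: "\<And>i. cand i (v i) (c i) (l i)"
    and minimal: "\<And>i u c' l'. cand i u c' l' \<Longrightarrow> (u, v i) \<notin> word_order"
    by metis
  define G where "G i b = c i * word_monom (v i) b + l i b" for i b
  have shape_v: "shape M (length (v i)) (v i)" and l: "l i \<in> lower_span M (v i)"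
    and not_van: "\<not> van i (length (v i)) (G i)" for i
    using cand[of i] by (auto simp: cand_def G_def[abs_def])
  have "\<forall>i. \<exists>N. van N (length (v i)) (G i)"
    using cand by (auto simp: cand_def G_def[abs_def])
  then obtain N where van_N: "\<And>i. van (N i) (length (v i)) (G i)"
    by metis
  have van_mono: "van n' q h" if "van n q h" "n \<le> n'" for n n' q h
    using that order_trans[of n n'] unfolding van_def by blast
  have min_van: "van i (length (v i)) h"
    if h: "h \<in> lower_span M (v i)" and "van n (length (v i)) h" for i n h
  proof (rule ccontr)
    assume nv: "\<not> van i (length (v i)) h"
    then have "h \<noteq> (\<lambda>_. 0)"
      by (auto simp: van_def)
    with leading_word[OF h[unfolded lower_span_def], of M "length (v i)"]
    obtain u c' l' where u: "shape M (length (v i)) u" "(u, v i) \<in> word_order" "l' \<in> lower_span M u"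
      "h = (\<lambda>a. c' * word_monom u a + l' a)"
      by auto
    then have "cand i u c' l'"
      using that nv shape_length[OF u(1)] by (auto simp: cand_def)
    then show False using minimal u by blast
  qed
  have c: "c i \<noteq> 0" for i
  proof
    assume "c i = 0"
    then have "G i = l i" by (auto simp: G_def)
    then show False using min_van[OF l, of "N i" i] van_N[of i] not_van[of i] by simp
  qed
  \<comment> \<open>Along \<open>idx\<close>, each chosen polynomial lies in the ideals of all later indices.\<close>
  define idx where "idx = rec_nat (0::nat) (\<lambda>_ x. max (Suc x) (N x))"
  have idx_Suc: "idx (Suc n) = max (Suc (idx n)) (N (idx n))" for n
    by (simp add: idx_def)
  have idx_mono: "strict_mono idx"
    by (simp add: strict_mono_Suc_iff idx_Suc less_max_iff_disj)
  have idx_N: "N (idx n) \<le> idx n'" if "n < n'" for n n'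
  proof -
    have "N (idx n) \<le> idx (Suc n)" by (simp add: idx_Suc)
    also have "\<dots> \<le> idx n'" using that idx_mono by (simp add: strict_mono_less_eq)
    finally show ?thesis .
  qed
  have "\<exists>n n'. n < n' \<and> list_emb (list_all2 (\<le>)) (v (idx n)) (v (idx n'))"
  proof (rule higman[where A = "{e. length e = M}"])
    fix f :: "nat \<Rightarrow> nat list"
    assume "\<And>i. f i \<in> {e. length e = M}"
    then show "\<exists>\<phi> :: nat \<Rightarrow> nat. strict_mono \<phi> \<and> (\<forall>i j. i < j \<longrightarrow> list_all2 (\<le>) (f (\<phi> i)) (f (\<phi> j)))"
      by (intro dickson) auto
  next
    show "set (v (idx i)) \<subseteq> {e. length e = M}" for i
      using shape_v[of "idx i"] by (auto simp: shape_def)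
  qed
  then obtain n n' where "n < n'" and emb: "list_emb (list_all2 (\<le>)) (v (idx n)) (v (idx n'))"
    by blast
  define i j where "i = idx n" and "j = idx n'"
  have Nij: "N i \<le> j" using idx_N \<open>n < n'\<close> by (simp add: i_def j_def)
  have emb: "list_emb (list_all2 (\<le>)) (v i) (v j)"
    using emb by (simp add: i_def j_def)
  obtain sel w Z where
    sel: "\<And>a :: (nat \<Rightarrow> 'k) list. length a = length (v j) \<Longrightarrow> subseq (sel a) a \<and> length (sel a) = length (v i)"
    and Z: "\<And>u'. shape M (length (v i)) u' \<Longrightarrow> shape M (length (v j)) (Z u')"
    and mon: "\<And>u' a. shape M (length (v i)) u' \<Longrightarrow>
        word_monom w a * word_monom u' (sel a) = word_monom (Z u') a"
    and Z_eq: "Z (v i) = v j"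
    and ord: "\<And>u'. shape M (length (v i)) u' \<Longrightarrow> (u', v i) \<in> word_order \<Longrightarrow> (Z u', v j) \<in> word_order"
    using word_embedding[OF emb shape_v shape_v, where 'k = 'k] by blast
  have G_sel: "van (N i) (length (v j)) (\<lambda>b. word_monom w b * G i (sel b))"
    unfolding van_def
  proof (intro allI impI)
    fix m b assume "N i \<le> m" "subseq b (a m)" "length b = length (v j)"
    moreover from this have "subseq (sel b) (a m)"
      using sel[of b] subseq_order.trans[of "sel b" b "a m"] by auto
    ultimately have "G i (sel b) = 0"
      using van_N[of i] sel[of b] unfolding van_def by blast
    then show "word_monom w b * G i (sel b) = 0" by simp
  qed
  \<comment> \<open>The leading terms of \<open>G j\<close> and of the multiple of the copy of \<open>G i\<close> cancel, only lower terms remain.\<close>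
  define h where "h b = l j b + (- (c j / c i)) * (word_monom w b * l i (sel b))" for b
  have "(\<lambda>b. word_monom w b * l i (sel b)) \<in> lower_span M (v j)"
    using l[of i] unfolding lower_span_def
  proof (rule fspan_transform)
    fix b :: "(nat \<Rightarrow> 'k) list \<Rightarrow> 'k"
    assume "b \<in> word_monom ` {u. shape M (length (v i)) u \<and> (u, v i) \<in> word_order}"
    then obtain u where u: "b = word_monom u" "shape M (length (v i)) u" "(u, v i) \<in> word_order"
      by auto
    then have "(\<lambda>a. word_monom w a * b (sel a)) = word_monom (Z u)"
      using mon by auto
    then show "(\<lambda>a. word_monom w a * b (sel a)) \<in>
        fspan (word_monom ` {u. shape M (length (v j)) u \<and> (u, v j) \<in> word_order})"
      using u Z ord by (auto intro!: fspan_base)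
  qed
  then have h_low: "h \<in> lower_span M (v j)"
    using l[of j] unfolding h_def[abs_def] lower_span_def by (intro fspan_add fspan_scale)
  have h_G: "G j b = h b + (c j / c i) * (word_monom w b * G i (sel b))" for b
    using mon[OF shape_v, of b] Z_eq c[of i] by (simp add: h_def G_def field_simps)
  have van_lin: "van n q (\<lambda>b. f b + x * f' b)" if "van n q f" "van n q f'" for n q x f f'
    using that by (simp add: van_def)
  have "h = (\<lambda>b. G j b + (- (c j / c i)) * (word_monom w b * G i (sel b)))"
    by (simp add: h_G fun_eq_iff)
  moreover have "van (max (N i) (N j)) (length (v j)) \<dots>"
    by (intro van_lin van_mono[OF G_sel] van_mono[OF van_N]) simp_all
  ultimately have "van j (length (v j)) h"
    by (intro min_van[OF h_low]) simp
  moreover have "G j = (\<lambda>b. h b + (c j / c i) * (word_monom w b * G i (sel b)))"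
    by (simp add: h_G fun_eq_iff)
  ultimately have "van j (length (v j)) (G j)"
    using van_lin[OF _ van_mono[OF G_sel Nij], of h "c j / c i"] by simp
  then show False using not_van by blast
qed

section \<open>Minors, and independence detected on few coordinates\<close>

definition fdet :: "nat \<Rightarrow> (nat \<Rightarrow> nat \<Rightarrow> 'k::field) \<Rightarrow> 'k" where
  "fdet n f = det (mat n n (\<lambda>(i, j). f i j))"

lemma fdet_cong: "(\<And>i j. i < n \<Longrightarrow> j < n \<Longrightarrow> f i j = g i j) \<Longrightarrow> fdet n f = fdet n g"
  unfolding fdet_def by (intro arg_cong[of _ _ det] eq_matI) auto

lemma fdet_leibniz:
  "fdet n f = (\<Sum>p\<in>{p. p permutes {0..<n}}. of_int (sign p) * (\<Prod>i<n. f i (p i)))"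
proof -
  have "fdet n f = (\<Sum>p\<in>{p. p permutes {0..<n}}. of_int (sign p) *
      (\<Prod>i = 0..<n. mat n n (\<lambda>(i, j). f i j) $$ (i, p i)))"
    unfolding fdet_def by (rule det_def') simp
  also have "\<dots> = (\<Sum>p\<in>{p. p permutes {0..<n}}. of_int (sign p) * (\<Prod>i = 0..<n. f i (p i)))"
  proof (intro sum.cong refl arg_cong2[of _ _ _ _ "(*)"] prod.cong)
    fix p i assume "p \<in> {p. p permutes {0..<n}}" "i \<in> {0..<n}"
    then have "p i < n" using permutes_in_image[of p "{0..<n}" i] by auto
    then show "mat n n (\<lambda>(i, j). f i j) $$ (i, p i) = f i (p i)"
      using \<open>i \<in> {0..<n}\<close> by simp
  qed
  finally show ?thesis by (simp add: lessThan_atLeast0)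
qed

lemma fdet_eq_0_iff:
  "fdet n f = 0 \<longleftrightarrow> (\<exists>c. (\<exists>i<n. c i \<noteq> 0) \<and> (\<forall>j<n. (\<Sum>i<n. c i * f i j) = 0))"
proof -
  let ?A = "mat n n (\<lambda>(i, j). f j i)"
  have "fdet n f = det ?A"
  proof -
    have "mat n n (\<lambda>(i, j). f i j) = transpose_mat ?A" by (intro eq_matI) auto
    then show ?thesis unfolding fdet_def using det_transpose[of ?A n] by simp
  qed
  also have "det ?A = 0 \<longleftrightarrow> (\<exists>v. v \<in> carrier_vec n \<and> v \<noteq> 0\<^sub>v n \<and> ?A *\<^sub>v v = 0\<^sub>v n)"
    by (rule det_0_iff_vec_prod_zero) simp
  also have "\<dots> \<longleftrightarrow> (\<exists>c. (\<exists>i<n. c i \<noteq> 0) \<and> (\<forall>j<n. (\<Sum>i<n. c i * f i j) = 0))"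
  proof safe
    fix v :: "'a vec" assume v: "v \<in> carrier_vec n" "v \<noteq> 0\<^sub>v n" "?A *\<^sub>v v = 0\<^sub>v n"
    have "(\<Sum>i<n. v $ i * f i j) = 0" if "j < n" for j
    proof -
      have "(?A *\<^sub>v v) $ j = 0" using v(3) that by simp
      then show ?thesis
        using that v(1) by (simp add: scalar_prod_def lessThan_atLeast0 mult.commute)
    qed
    moreover have "\<exists>i<n. v $ i \<noteq> 0"
      using v by (metis carrier_vecD eq_vecI index_zero_vec(1) index_zero_vec(2))
    ultimately show "\<exists>c. (\<exists>i<n. c i \<noteq> 0) \<and> (\<forall>j<n. (\<Sum>i<n. c i * f i j) = 0)"
      by (intro exI[of _ "\<lambda>i. v $ i"]) auto
  next
    fix c i assume c: "\<forall>j<n. (\<Sum>i<n. c i * f i j) = 0" and i: "i < n" "c i \<noteq> 0"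
    have "?A *\<^sub>v vec n c = 0\<^sub>v n"
      using c by (intro eq_vecI) (auto simp: scalar_prod_def lessThan_atLeast0 mult.commute)
    moreover have "vec n c \<noteq> 0\<^sub>v n"
      using i by (metis index_vec index_zero_vec(1))
    ultimately show "\<exists>v. v \<in> carrier_vec n \<and> v \<noteq> 0\<^sub>v n \<and> ?A *\<^sub>v v = 0\<^sub>v n"
      by (intro exI[of _ "vec n c"]) auto
  qed
  finally show ?thesis .
qed

lemma fdet_nonzero_inverse:
  assumes "fdet n f \<noteq> 0"
  obtains g where "\<And>i j. i < n \<Longrightarrow> j < n \<Longrightarrow> (\<Sum>u<n. f i u * g u j) = (if i = j then 1 else 0)"
    and "\<And>i j. i < n \<Longrightarrow> j < n \<Longrightarrow> (\<Sum>u<n. g i u * f u j) = (if i = j then 1 else 0)"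
proof -
  let ?A = "mat n n (\<lambda>(i, j). f i j)"
  have "?A \<in> Units (ring_mat TYPE('a) n undefined)"
    using assms by (intro det_non_zero_imp_unit) (auto simp: fdet_def)
  then obtain B where B: "B \<in> carrier_mat n n" "B * ?A = 1\<^sub>m n" "?A * B = 1\<^sub>m n"
    unfolding Units_def ring_mat_def by auto
  show ?thesis
  proof (rule that[of "\<lambda>i j. B $$ (i, j)"])
    fix i j assume ij: "i < n" "j < n"
    have "(?A * B) $$ (i, j) = (if i = j then 1 else 0)" using B ij by simp
    then show "(\<Sum>u<n. f i u * B $$ (u, j)) = (if i = j then 1 else 0)"
      using B(1) ij by (simp add: scalar_prod_def lessThan_atLeast0)
    have "(B * ?A) $$ (i, j) = (if i = j then 1 else 0)" using B ij by simp
    then show "(\<Sum>u<n. B $$ (i, u) * f u j) = (if i = j then 1 else 0)"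
      using B(1) ij by (simp add: scalar_prod_def lessThan_atLeast0)
  qed
qed

lemma fdet_rank_deficient:
  fixes u v :: "nat \<Rightarrow> nat \<Rightarrow> 'k::field"
  assumes "r < n"
  shows "fdet n (\<lambda>i j. \<Sum>t<r. u t i * v t j) = 0"
proof -
  let ?U = "mat n n (\<lambda>(i, t). if t < r then u t i else 0)"
  let ?V = "mat n n (\<lambda>(t, j). if t < r then v t j else 0)"
  have eq: "mat n n (\<lambda>(i, j). \<Sum>t<r. u t i * v t j) = ?U * ?V"
  proof (intro eq_matI)
    fix i j assume "i < dim_row (?U * ?V)" "j < dim_col (?U * ?V)"
    then have ij: "i < n" "j < n" by auto
    have "(?U * ?V) $$ (i, j) = (\<Sum>t = 0..<n. (if t < r then u t i else 0) * (if t < r then v t j else 0))"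
      using ij by (simp add: scalar_prod_def)
    also have "\<dots> = (\<Sum>t<r. u t i * v t j)"
      using assms by (intro sum.mono_neutral_cong_right) auto
    finally show "mat n n (\<lambda>(i, j). \<Sum>t<r. u t i * v t j) $$ (i, j) = (?U * ?V) $$ (i, j)"
      using ij by simp
  qed auto
  have "fdet n (\<lambda>t j. if t < r then v t j else 0) = 0"
    unfolding fdet_eq_0_iff using assms
    by (intro exI[of _ "\<lambda>i. if i = r then 1 else 0"]) (auto intro!: sum.neutral exI[of _ r])
  then have "det ?V = 0" by (simp add: fdet_def)
  then show ?thesis
    unfolding fdet_def eq using det_mult[of ?U n ?V] by simp
qed

text \<open>
  If a nonzero minor cannot be enlarged by the row \<open>x\<close> and the column \<open>y\<close>, the entry at \<open>(x, y)\<close> is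
  determined by the entries in the rows and columns of the minor: its Schur complement is zero.
\<close>

lemma bordered_minor:
  fixes M :: "'x \<Rightarrow> 'y \<Rightarrow> 'k::field"
  assumes nz: "fdet r (\<lambda>s t. M (xs s) (ys t)) \<noteq> 0"
    and z: "fdet (Suc r) (\<lambda>s t. M (if s < r then xs s else x) (if t < r then ys t else y)) = 0"
    and G: "\<And>i j. i < r \<Longrightarrow> j < r \<Longrightarrow> (\<Sum>u<r. M (xs i) (ys u) * G u j) = (if i = j then 1 else 0)"
  shows "M x y = (\<Sum>u<r. (\<Sum>w<r. M x (ys w) * G w u) * M (xs u) y)"
proof -
  from z obtain c i0 where "i0 < Suc r" "c i0 \<noteq> 0"
    and c: "\<And>j. j < Suc r \<Longrightarrow>
      (\<Sum>i<Suc r. c i * M (if i < r then xs i else x) (if j < r then ys j else y)) = 0"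
    unfolding fdet_eq_0_iff by blast
  have c1: "(\<Sum>i<r. c i * M (xs i) (ys j)) + c r * M x (ys j) = 0" if "j < r" for j
    using c[of j] that by simp
  have c2: "(\<Sum>i<r. c i * M (xs i) y) + c r * M x y = 0"
    using c[of r] by simp
  \<comment> \<open>Otherwise the rows of the nonzero minor would be dependent.\<close>
  have cr: "c r \<noteq> 0"
  proof
    assume "c r = 0"
    then have "i0 < r" using \<open>i0 < Suc r\<close> \<open>c i0 \<noteq> 0\<close> by (cases "i0 = r") auto
    then have "fdet r (\<lambda>s t. M (xs s) (ys t)) = 0"
      unfolding fdet_eq_0_iff using c1 \<open>c r = 0\<close> \<open>c i0 \<noteq> 0\<close> by (intro exI[of _ c]) auto
    then show False using nz by simp
  qed
  define b where "b i = - c i / c r" for i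
  have solve: "m = (\<Sum>i<r. b i * g i)" if "(\<Sum>i<r. c i * g i) + c r * m = 0" for g m
  proof -
    have "(\<Sum>i<r. b i * g i) = (\<Sum>i<r. c i * g i) * (- 1 / c r)"
      unfolding sum_distrib_right by (intro sum.cong) (simp_all add: b_def)
    also have "(\<Sum>i<r. c i * g i) = - (c r * m)"
      using that by (simp add: eq_neg_iff_add_eq_0)
    also have "\<dots> * (- 1 / c r) = m" using cr by simp
    finally show ?thesis by simp
  qed
  have "(\<Sum>w<r. M x (ys w) * G w u) = b u" if "u < r" for u
  proof -
    have "(\<Sum>w<r. M x (ys w) * G w u) = (\<Sum>w<r. (\<Sum>i<r. b i * M (xs i) (ys w)) * G w u)"
      by (intro sum.cong refl) (simp flip: solve[OF c1])
    also have "\<dots> = (\<Sum>w<r. \<Sum>i<r. b i * (M (xs i) (ys w) * G w u))"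
      by (simp add: sum_distrib_right mult.assoc)
    also have "\<dots> = (\<Sum>i<r. b i * (\<Sum>w<r. M (xs i) (ys w) * G w u))"
      by (subst sum.swap) (simp add: sum_distrib_left)
    also have "\<dots> = (\<Sum>i<r. if i = u then b i else 0)"
      using that by (intro sum.cong) (auto simp: G)
    also have "\<dots> = b u" using that by simp
    finally show ?thesis .
  qed
  then show ?thesis
    using solve[OF c2] by simp
qed

definition independent_on :: "'y set \<Rightarrow> nat \<Rightarrow> (nat \<Rightarrow> 'y \<Rightarrow> 'k::field) \<Rightarrow> bool" where
  "independent_on Y r t \<longleftrightarrow> (\<forall>c. (\<forall>y\<in>Y. (\<Sum>s<r. c s * t s y) = 0) \<longrightarrow> (\<forall>s<r. c s = 0))"

lemma independent_onD:
  assumes "independent_on Y r t" "\<And>y. y \<in> Y \<Longrightarrow> (\<Sum>s<r. c s * t s y) = 0" "s < r"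
  shows "c s = 0"
  using assms unfolding independent_on_def by blast

lemma minor_imp_independent:
  assumes "fdet r (\<lambda>s u. t s (y u)) \<noteq> 0" "\<And>u. u < r \<Longrightarrow> y u \<in> Y"
  shows "independent_on Y r t"
  using assms unfolding fdet_eq_0_iff independent_on_def by blast

lemma independent_on_less:
  assumes "independent_on Y (Suc r) t"
  shows "independent_on Y r t"
  unfolding independent_on_def
proof (intro allI impI)
  fix c s assume c: "\<forall>y\<in>Y. (\<Sum>s<r. c s * t s y) = 0" and "s < r"
  have "(if s < r then c s else 0) = 0"
    by (rule independent_onD[OF assms, where c = "\<lambda>s. if s < r then c s else 0"])
      (use c \<open>s < r\<close> in auto)
  then show "c s = 0" using \<open>s < r\<close> by simp
qed

text \<open>
  Extend a nonzero minor for the first \<open>r\<close> functions. If no point \<open>z\<close> of \<open>Y\<close> enlarged it, the bordered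
  minors would express the last function through the others, with coefficients not depending on \<open>z\<close>.
\<close>

lemma independent_imp_minor:
  assumes "independent_on Y r t"
  shows "\<exists>y. (\<forall>u<r. y u \<in> Y) \<and> fdet r (\<lambda>s u. t s (y u)) \<noteq> 0"
  using assms
proof (induction r)
  case 0
  show ?case by (auto simp: fdet_eq_0_iff)
next
  case (Suc r)
  from Suc.IH[OF independent_on_less[OF Suc.prems]] obtain y where y: "\<forall>u<r. y u \<in> Y"
    and nz: "fdet r (\<lambda>s u. t s (y u)) \<noteq> 0"
    by blast
  from nz obtain G where
    G: "\<And>i j. i < r \<Longrightarrow> j < r \<Longrightarrow> (\<Sum>u<r. t i (y u) * G u j) = (if i = j then 1 else 0)"
    by (rule fdet_nonzero_inverse) blast
  show ?case
  proof (rule ccontr)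
    assume contra: "\<not> ?case"
    define c where "c s = (if s < r then - (\<Sum>w<r. t r (y w) * G w s) else 1)" for s
    have "(\<Sum>s<Suc r. c s * t s z) = 0" if "z \<in> Y" for z
    proof -
      let ?y = "\<lambda>u. if u < r then y u else z"
      have y': "\<forall>u<Suc r. ?y u \<in> Y"
        using y that by simp
      have "fdet (Suc r) (\<lambda>s u. t s (?y u)) = 0"
      proof (rule ccontr)
        assume "fdet (Suc r) (\<lambda>s u. t s (?y u)) \<noteq> 0"
        then have ?case using y' by (intro exI[of _ ?y] conjI)
        then show False using contra by contradiction
      qed
      moreover have "fdet (Suc r) (\<lambda>s u. t (if s < r then s else r) (?y u)) =
          fdet (Suc r) (\<lambda>s u. t s (?y u))"
        by (rule fdet_cong) (auto simp: less_Suc_eq)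
      ultimately have "fdet (Suc r) (\<lambda>s u. t (if s < r then s else r) (?y u)) = 0"
        by simp
      from bordered_minor[of r t "\<lambda>s. s" y, OF nz this G]
      have "t r z = (\<Sum>u<r. (\<Sum>w<r. t r (y w) * G w u) * t u z)" .
      then show ?thesis by (simp add: c_def sum_negf)
    qed
    then have "c r = 0"
      using independent_onD[OF Suc.prems] by blast
    then show False by (simp add: c_def)
  qed
qed

definition polynomial_function :: "('k::field \<Rightarrow> 'k) \<Rightarrow> bool" where
  "polynomial_function g \<longleftrightarrow> (\<exists>p. \<forall>e. g e = poly p e)"

lemma polynomial_function_const: "polynomial_function (\<lambda>e. c)"
  unfolding polynomial_function_def by (rule exI[of _ "[:c:]"]) simp

lemma polynomial_function_linear: "polynomial_function (\<lambda>e. c + e * d)"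
  unfolding polynomial_function_def by (rule exI[of _ "[:c, d:]"]) simp

lemma polynomial_function_mult:
  "polynomial_function f \<Longrightarrow> polynomial_function g \<Longrightarrow> polynomial_function (\<lambda>e. f e * g e)"
  unfolding polynomial_function_def by (metis poly_mult)

lemma polynomial_function_sum:
  assumes "\<And>i. i \<in> I \<Longrightarrow> polynomial_function (f i)"
  shows "polynomial_function (\<lambda>e. \<Sum>i\<in>I. f i e)"
proof -
  obtain p where "\<And>i e. i \<in> I \<Longrightarrow> f i e = poly (p i) e"
    using assms unfolding polynomial_function_def by metis
  then show ?thesis
    unfolding polynomial_function_def by (intro exI[of _ "\<Sum>i\<in>I. p i"]) (simp add: poly_sum)
qed

lemma polynomial_function_prod:
  assumes "\<And>i. i \<in> I \<Longrightarrow> polynomial_function (f i)"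
  shows "polynomial_function (\<lambda>e. \<Prod>i\<in>I. f i e)"
proof -
  obtain p where "\<And>i e. i \<in> I \<Longrightarrow> f i e = poly (p i) e"
    using assms unfolding polynomial_function_def by metis
  then show ?thesis
    unfolding polynomial_function_def by (intro exI[of _ "\<Prod>i\<in>I. p i"]) (simp add: poly_prod)
qed

lemma polynomial_function_fdet:
  assumes "\<And>i j. polynomial_function (\<lambda>e. f e i j)"
  shows "polynomial_function (\<lambda>e. fdet n (f e))"
  unfolding fdet_leibniz
  by (intro polynomial_function_sum polynomial_function_mult polynomial_function_const
      polynomial_function_prod assms)

text \<open>
  The product of the polynomials is nonzero and has only finitely many roots. This is where the field
  has to be infinite.
\<close>

lemma common_nonzero:
  assumes inf: "infinite (UNIV :: 'k::field set)" and "finite I"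
    and pf: "\<And>i. i \<in> I \<Longrightarrow> polynomial_function (g i)"
    and nz: "\<And>i. i \<in> I \<Longrightarrow> \<exists>e. g i e \<noteq> 0"
  shows "\<exists>e::'k. \<forall>i\<in>I. g i e \<noteq> 0"
proof -
  obtain p where p: "\<And>i e. i \<in> I \<Longrightarrow> g i e = poly (p i) e"
    using pf unfolding polynomial_function_def by metis
  then have "p i \<noteq> 0" if "i \<in> I" for i
    using nz[OF that] that by auto
  then have "finite {e. poly (\<Prod>i\<in>I. p i) e = 0}"
    using \<open>finite I\<close> by (intro poly_roots_finite) simp
  then obtain e where "poly (\<Prod>i\<in>I. p i) e \<noteq> 0"
    using ex_new_if_finite[OF inf] by blast
  then show ?thesis
    using p \<open>finite I\<close> by (intro exI[of _ e]) (simp add: poly_prod)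
qed

definition agreeing_off :: "nat set \<Rightarrow> (nat \<Rightarrow> 'v) \<Rightarrow> (nat \<Rightarrow> 'v) set" where
  "agreeing_off S l = {y. \<forall>a. a \<notin> S \<longrightarrow> y a = l a}"

text \<open>
  One coordinate suffices for each additional function. Suppose that the
  first \<open>r\<close> functions are independent on \<open>agreeing_off S l\<close>, but that a combination \<open>\<tau>\<close> involving the
  last one vanishes there. Move \<open>l\<close> towards a point where \<open>\<tau>\<close> does not vanish, one coordinate after the
  other, each time by the same proportion \<open>e\<close> of the way, which is chosen generically so that the first
  \<open>r\<close> functions stay independent throughout. At some coordinate \<open>i\<close> the combination \<open>\<tau>\<close> stops
  vanishing; freeing this coordinate makes all \<open>r + 1\<close> functions independent.
\<close>

lemma independent_on_few_coordinates:
  fixes t :: "nat \<Rightarrow> (nat \<Rightarrow> nat \<Rightarrow> 'k::field) \<Rightarrow> 'k"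
  assumes inf: "infinite (UNIV :: 'k set)"
    and dep: "\<And>s y z. (\<And>a. a < p \<Longrightarrow> y a = z a) \<Longrightarrow> t s y = t s z"
    and pf: "\<And>s y d. polynomial_function (\<lambda>e. t s (\<lambda>a v. y a v + e * d a v))"
    and indep: "independent_on UNIV r t"
  shows "\<exists>S l. S \<subseteq> {..<p} \<and> card S \<le> r \<and> independent_on (agreeing_off S l) r t"
  using indep
proof (induction r)
  case 0
  then show ?case by (intro exI[of _ "{}"]) (auto simp: independent_on_def)
next
  case (Suc r)
  from Suc.IH[OF independent_on_less[OF Suc.prems]] obtain S l where
    S: "S \<subseteq> {..<p}" "card S \<le> r" and ind: "independent_on (agreeing_off S l) r t"
    by blast
  show ?case
  proof (cases "independent_on (agreeing_off S l) (Suc r) t")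
    case True
    then show ?thesis using S by (meson le_SucI)
  next
    case False
    then obtain c where c: "\<forall>y\<in>agreeing_off S l. (\<Sum>s<Suc r. c s * t s y) = 0"
      and "\<not> (\<forall>s<Suc r. c s = 0)"
      by (auto simp only: independent_on_def)
    then obtain s0 where s0: "s0 < Suc r" "c s0 \<noteq> 0"
      by blast
    define \<tau> where "\<tau> y = (\<Sum>s<Suc r. c s * t s y)" for y
    have cr: "c r \<noteq> 0"
    proof
      assume "c r = 0"
      then have "\<forall>y\<in>agreeing_off S l. (\<Sum>s<r. c s * t s y) = 0"
        using c by simp
      then have "\<forall>s<r. c s = 0" using independent_onD[OF ind, of c] by blast
      then show False using s0 \<open>c r = 0\<close> less_Suc_eq by auto
    qed
    obtain z where z: "\<tau> z \<noteq> 0"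
      using independent_onD[OF Suc.prems, of c s0] s0 unfolding \<tau>_def by blast
    obtain y where y: "\<forall>u<r. y u \<in> agreeing_off S l" and nz: "fdet r (\<lambda>s u. t s (y u)) \<noteq> 0"
      using independent_imp_minor[OF ind] by (elim exE conjE)
    \<comment> \<open>The point that equals \<open>w\<close> on \<open>S\<close> and, off \<open>S\<close>, has moved from \<open>l\<close> towards \<open>z\<close> in the coordinates
      before \<open>i\<close>.\<close>
    define pt where "pt e i w a v = (if a \<in> S then w a v else l a v) +
        e * (if a \<notin> S \<and> a < i then z a v - l a v else 0)"
      for e i and w :: "nat \<Rightarrow> nat \<Rightarrow> 'k" and a v
    have pf_pt: "polynomial_function (\<lambda>e. t s (pt e i w))" for s i w
      using pf[of s "\<lambda>a v. if a \<in> S then w a v else l a v"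
          "\<lambda>a v. if a \<notin> S \<and> a < i then z a v - l a v else 0"]
      by (simp add: pt_def[abs_def])
    \<comment> \<open>The finitely many polynomials in \<open>e\<close> that must not vanish: \<open>\<tau>\<close> at the end point (\<open>n = 0\<close>), and the
      minor after \<open>n - 1\<close> moves. The first is nonzero for \<open>e = 1\<close>, the others for \<open>e = 0\<close>.\<close>
    define g where "g n e = (if n = 0 then \<tau> (pt e p z) else fdet r (\<lambda>s u. t s (pt e (n - 1) (y u))))"
      for n e
    have "\<exists>e. \<forall>n\<in>{..Suc p}. g n e \<noteq> 0"
    proof (rule common_nonzero[OF inf])
      show "polynomial_function (g n)" for n
      proof (cases "n = 0")
        case True
        then have "g n = (\<lambda>e. \<Sum>s<Suc r. c s * t s (pt e p z))" by (auto simp: g_def \<tau>_def)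
        then show ?thesis
          by (simp only:) (intro polynomial_function_sum polynomial_function_mult
              polynomial_function_const pf_pt)
      next
        case False
        then have "g n = (\<lambda>e. fdet r (\<lambda>s u. t s (pt e (n - 1) (y u))))" by (auto simp: g_def)
        then show ?thesis by (simp only:) (intro polynomial_function_fdet pf_pt)
      qed
      show "\<exists>e. g n e \<noteq> 0" for n
      proof (cases "n = 0")
        case True
        have "t s (pt 1 p z) = t s z" for s
          by (rule dep) (auto simp: pt_def fun_eq_iff)
        then have "g n 1 = \<tau> z" using True by (simp add: g_def \<tau>_def)
        then show ?thesis using z by metis
      next
        case False
        have "pt 0 i (y u) = y u" if "u < r" for i u
          using y[rule_format, of u] that by (auto simp: pt_def agreeing_off_def fun_eq_iff)
        then have "fdet r (\<lambda>s u. t s (pt 0 (n - 1) (y u))) = fdet r (\<lambda>s u. t s (y u))"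
          by (intro fdet_cong) simp
        then have "g n 0 \<noteq> 0" using False nz by (simp add: g_def)
        then show ?thesis by blast
      qed
    qed simp
    then obtain e where e: "\<And>n. n \<le> Suc p \<Longrightarrow> g n e \<noteq> 0" by auto
    define h where "h i = pt e i l" for i
    have pt_in: "pt e i w \<in> agreeing_off S (h i)" for i w
      by (auto simp: agreeing_off_def h_def pt_def fun_eq_iff)
    have ind_h: "independent_on (agreeing_off S (h i)) r t" if "i \<le> p" for i
      using e[of "Suc i"] that pt_in
      by (intro minor_imp_independent[where y = "\<lambda>u. pt e i (y u)"]) (auto simp: g_def)
    define van where "van i \<longleftrightarrow> (\<forall>y\<in>agreeing_off S (h i). \<tau> y = 0)" for i
    have "h 0 = l" by (auto simp: h_def pt_def fun_eq_iff)
    then have van0: "van 0" using c by (simp add: van_def \<tau>_def)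
    have "\<not> van p" using e[of 0] pt_in[of p z] by (auto simp: van_def g_def)
    then obtain i where i: "i < p" "van i" "\<not> van (Suc i)"
    proof -
      define n where "n = (LEAST n. \<not> van n)"
      have n: "\<not> van n" "n \<le> p"
        unfolding n_def using \<open>\<not> van p\<close> by (rule LeastI, rule Least_le)
      then obtain i where "n = Suc i" using van0 by (cases n) auto
      moreover have "van i"
        using not_less_Least[of i "\<lambda>n. \<not> van n"] \<open>n = Suc i\<close> by (auto simp: n_def[symmetric])
      ultimately show ?thesis using n that[of i] by simp
    qed
    have sub1: "agreeing_off S (h i) \<subseteq> agreeing_off (insert i S) (h i)"
      by (auto simp: agreeing_off_def)
    have sub2: "agreeing_off S (h (Suc i)) \<subseteq> agreeing_off (insert i S) (h i)"
      by (auto simp: agreeing_off_def h_def pt_def fun_eq_iff less_Suc_eq)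
    have "independent_on (agreeing_off (insert i S) (h i)) (Suc r) t"
      unfolding independent_on_def
    proof (rule allI, rule impI)
      fix c' assume c': "\<forall>y\<in>agreeing_off (insert i S) (h i). (\<Sum>s<Suc r. c' s * t s y) = 0"
      \<comment> \<open>Subtracting \<open>\<mu>\<close> times the relation \<open>\<tau>\<close> eliminates the last function.\<close>
      define \<mu> where "\<mu> = c' r / c r"
      have z0: "(\<Sum>s<r. (c' s - \<mu> * c s) * t s y) = 0" if y: "y \<in> agreeing_off S (h i)" for y
      proof -
        have "(\<Sum>s<r. (c' s - \<mu> * c s) * t s y) = (\<Sum>s<Suc r. (c' s - \<mu> * c s) * t s y)"
          using cr by (simp add: \<mu>_def)
        also have "\<dots> = (\<Sum>s<Suc r. c' s * t s y) - \<mu> * \<tau> y"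
          by (simp only: \<tau>_def sum_distrib_left left_diff_distrib sum_subtractf mult.assoc)
        also have "\<dots> = 0" using c' y sub1 i(2) by (auto simp: van_def)
        finally show ?thesis .
      qed
      have "c' s - \<mu> * c s = 0" if "s < r" for s
        by (rule independent_onD[OF ind_h[OF less_imp_le[OF i(1)]], of "\<lambda>s. c' s - \<mu> * c s",
              OF z0 that])
      then have c'_eq: "c' s = \<mu> * c s" if "s < Suc r" for s
        using that cr by (cases "s = r") (auto simp: \<mu>_def less_Suc_eq)
      obtain y where y: "y \<in> agreeing_off S (h (Suc i))" "\<tau> y \<noteq> 0"
        using i(3) by (auto simp: van_def)
      have "(\<Sum>s<Suc r. c' s * t s y) = 0" using c' y(1) sub2 by blast
      moreover have "(\<Sum>s<Suc r. c' s * t s y) = \<mu> * \<tau> y"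
        unfolding \<tau>_def sum_distrib_left by (intro sum.cong) (auto simp: c'_eq)
      ultimately have "\<mu> = 0" using y(2) by simp
      then show "\<forall>s<Suc r. c' s = 0" using c'_eq by simp
    qed
    moreover have "card (insert i S) \<le> Suc r"
      using S(2) card_insert_le_m1[of "Suc r" S i] by simp
    ultimately show ?thesis
      using i(1) S(1) by (intro exI[of _ "insert i S"] exI[of _ "h i"] conjI) simp_all
  qed
qed

section \<open>Matrix products\<close>

text \<open>
  With rows indexed by \<open>x\<close> and columns by \<open>y\<close>, the matrix of the values \<open>F (merge J x y)\<close> is the
  flattening of a multilinear form \<open>F\<close> along the positions in \<open>J\<close> and their complement.
\<close>

definition merge :: "nat set \<Rightarrow> (nat \<Rightarrow> 'v) \<Rightarrow> (nat \<Rightarrow> 'v) \<Rightarrow> nat \<Rightarrow> 'v" where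
  "merge J x y = (\<lambda>a. if a \<in> J then x a else y a)"

text \<open>
  The entry at \<open>(s, t)\<close> of the product of the \<open>r \<times> r\<close> matrices \<open>X a (y a)\<close> over a list of positions \<open>a\<close>.
\<close>

fun mat_chain :: "nat \<Rightarrow> (nat \<Rightarrow> 'v \<Rightarrow> nat \<Rightarrow> nat \<Rightarrow> 'k::field) \<Rightarrow> nat list \<Rightarrow> (nat \<Rightarrow> 'v) \<Rightarrow> nat \<Rightarrow> nat \<Rightarrow> 'k" where
  "mat_chain r X [] y s t = (if s = t then 1 else 0)"
| "mat_chain r X (a # as) y s t = (\<Sum>u<r. X a (y a) s u * mat_chain r X as y u t)"

text \<open>
  Choose \<open>r\<close> maximal such that some flattening along at most \<open>r\<close> positions \<open>J\<close> has a nonzero minor of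
  size \<open>r\<close>. Adding one position \<open>a\<close> to \<open>J\<close> gives at most \<open>r + 1\<close> positions, so by maximality the
  flattening along \<open>J\<close> and \<open>a\<close> has rank at most \<open>r\<close>. By \<open>independent_on_few_coordinates\<close>, the columns of the
  minor can be chosen to agree with one point \<open>l\<close> off a set \<open>S\<close> of at most \<open>r\<close> positions. Then the same minor,
  with \<open>l\<^sub>a\<close> moved from the columns to the rows, is a nonzero maximal minor of the flattening along
  \<open>J\<close> and \<open>a\<close>, and the bordered minor formula splits off a matrix \<open>X\<^sub>a\<close> that depends on \<open>y\<^sub>a\<close> only.
  Doing this for all positions outside the head \<open>J \<union> S\<close> gives the product. At \<open>l\<^sub>a\<close> the matrix \<open>X\<^sub>a\<close>
  is the minor times its inverse.
\<close>

theorem matrix_product_form: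
  fixes F :: "(nat \<Rightarrow> nat \<Rightarrow> 'k::field) \<Rightarrow> 'k"
  assumes inf: "infinite (UNIV :: 'k set)"
    and dep: "\<And>y z. (\<And>a. a < p \<Longrightarrow> y a = z a) \<Longrightarrow> F y = F z"
    and pf: "\<And>y d. polynomial_function (\<lambda>e. F (\<lambda>a v. y a v + e * d a v))"
    and rank: "\<And>J xs ys. J \<subseteq> {..<p} \<Longrightarrow> fdet (Suc k) (\<lambda>s t. F (merge J (xs s) (ys t))) = 0"
  shows "\<exists>r hs qs l B X. r \<le> k \<and> distinct (hs @ qs) \<and> set (hs @ qs) = {..<p} \<and> length hs \<le> 2 * k \<and>
    (\<forall>a\<in>set qs. \<forall>s<r. \<forall>u<r. X a (l a) s u = (if s = u then 1 else 0)) \<and>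
    (\<forall>y. F y = (\<Sum>s<r. \<Sum>t<r. B s t (map y hs) * mat_chain r X qs y s t))"
proof -
  define good where "good r \<longleftrightarrow> r \<le> k \<and> (\<exists>J\<subseteq>{..<p}. card J \<le> r \<and>
      (\<exists>xs ys. fdet r (\<lambda>s t. F (merge J (xs s) (ys t))) \<noteq> 0))" for r
  have "good 0"
    unfolding good_def by (auto simp: fdet_eq_0_iff intro: exI[of _ "{}"])
  define r where "r = (GREATEST r. good r)"
  have good: "good r" and greatest: "\<And>r'. good r' \<Longrightarrow> r' \<le> r"
    unfolding r_def
    using GreatestI_nat[of good 0 k] Greatest_le_nat[of good _ k] \<open>good 0\<close> by (auto simp: good_def)
  then have "r \<le> k" by (simp add: good_def)
  from good obtain J xs ys0 where J: "J \<subseteq> {..<p}" "card J \<le> r"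
    and nz0: "fdet r (\<lambda>s t. F (merge J (xs s) (ys0 t))) \<noteq> 0"
    unfolding good_def by blast
  have maximal: "fdet (Suc r) (\<lambda>s t. F (merge J' (xs' s) (ys' t))) = 0"
    if "J' \<subseteq> {..<p}" "card J' \<le> Suc r" for J' xs' ys'
  proof (cases "r = k")
    case True
    then show ?thesis using rank that by simp
  next
    case False
    show ?thesis
    proof (rule ccontr)
      assume "\<not> ?thesis"
      then have "good (Suc r)"
        using that False \<open>r \<le> k\<close> unfolding good_def by auto
      then show False using greatest[of "Suc r"] by simp
    qed
  qed
  define t where "t s y = F (merge J (xs s) y)" for s y
  have "\<exists>S l. S \<subseteq> {..<p} \<and> card S \<le> r \<and> independent_on (agreeing_off S l) r t"
  proof (rule independent_on_few_coordinates[OF inf])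
    show "t s y = t s z" if "\<And>a. a < p \<Longrightarrow> y a = z a" for s y z
      unfolding t_def using that by (intro dep) (auto simp: merge_def)
    show "polynomial_function (\<lambda>e. t s (\<lambda>a v. y a v + e * d a v))" for s y d
    proof -
      have "(\<lambda>e. t s (\<lambda>a v. y a v + e * d a v)) =
          (\<lambda>e. F (\<lambda>a v. merge J (xs s) y a v + e * merge J (\<lambda>_ _. 0) d a v))"
        unfolding t_def by (intro ext arg_cong[of _ _ F]) (auto simp: merge_def fun_eq_iff)
      then show ?thesis using pf by simp
    qed
    show "independent_on UNIV r t"
      using nz0 by (intro minor_imp_independent[where y = ys0]) (auto simp: t_def)
  qed
  then obtain S l where S: "S \<subseteq> {..<p}" "card S \<le> r"
    and ind: "independent_on (agreeing_off S l) r t"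
    by blast
  obtain ys where ys: "\<forall>u<r. ys u \<in> agreeing_off S l"
    and nz: "fdet r (\<lambda>s u. t s (ys u)) \<noteq> 0"
    using independent_imp_minor[OF ind] by (elim exE conjE)
  from nz obtain G where
    G: "\<And>i j. i < r \<Longrightarrow> j < r \<Longrightarrow> (\<Sum>u<r. t i (ys u) * G u j) = (if i = j then 1 else 0)"
    by (rule fdet_nonzero_inverse) blast
  have ys_l: "ys u a = l a" if "u < r" "a \<notin> S" for u a
    using ys that by (auto simp: agreeing_off_def)
  have fin: "finite J" "finite S"
    using J S by (auto intro: finite_subset)
  define hs where "hs = sorted_list_of_set (J \<union> S)"
  define qs where "qs = sorted_list_of_set ({..<p} - (J \<union> S))"
  have set_hs: "set hs = J \<union> S" and set_qs: "set qs = {..<p} - (J \<union> S)"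
    using fin by (simp_all add: hs_def qs_def)
  have len_hs: "length hs \<le> 2 * k"
  proof -
    have "length hs = card (J \<union> S)" using fin by (simp add: hs_def)
    also have "\<dots> \<le> card J + card S" by (rule card_Un_le)
    finally show ?thesis using J S \<open>r \<le> k\<close> by simp
  qed
  have dist: "distinct (hs @ qs)"
  proof -
    have "distinct hs" "distinct qs" by (simp_all add: hs_def qs_def)
    then show ?thesis using set_hs set_qs by auto
  qed
  have set_all: "set (hs @ qs) = {..<p}"
    unfolding set_append set_hs set_qs using J(1) S(1) by blast
  define X where "X a v s u = (\<Sum>w<r. F (merge J (xs s) ((ys w)(a := v))) * G w u)" for a v s u
  \<comment> \<open>\<open>Z s A y\<close> is the value of \<open>F\<close> in the base row \<open>s\<close> when only the positions in \<open>A\<close> and \<open>S\<close> take their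
    values from \<open>y\<close>; the positions of \<open>A\<close> are peeled off one by one.\<close>
  define Z where "Z s A y = F (merge J (xs s) (\<lambda>b. if b \<in> set A \<union> S then y b else l b))" for s A y
  have X_id: "X a (l a) s u = (if s = u then 1 else 0)" if "a \<in> set qs" "s < r" "u < r" for a s u
  proof -
    have "a \<notin> S" using \<open>a \<in> set qs\<close> unfolding set_qs by blast
    then have upd: "(ys w)(a := l a) = ys w" if "w < r" for w
      using ys_l[OF that] by (simp add: fun_upd_idem)
    have "X a (l a) s u = (\<Sum>w<r. t s (ys w) * G w u)"
      unfolding X_def t_def by (intro sum.cong refl) (simp add: upd)
    then show ?thesis using G that by simp
  qed
  have peel: "Z s (a # A) y = (\<Sum>u<r. X a (y a) s u * Z u A y)"
    if a: "a \<in> set qs" "a \<notin> set A" and "s < r" for s a A y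
  proof -
    have aJ: "a \<notin> J" "a \<notin> S" "a < p" using a(1) unfolding set_qs by auto
    let ?J = "insert a J" and ?x = "(xs s)(a := y a)" and ?xs = "\<lambda>u. (xs u)(a := l a)"
    let ?y = "\<lambda>b. if b \<in> set A \<union> S then y b else l b"
    \<comment> \<open>The columns \<open>ys j\<close> have the value \<open>l a\<close> at \<open>a\<close>, so the minor is the same for \<open>J\<close> and for \<open>insert a J\<close>.\<close>
    have base: "F (merge ?J (?xs i) (ys j)) = t i (ys j)" if "j < r" for i j
      unfolding t_def using aJ ys_l[OF that] by (intro arg_cong[of _ _ F]) (auto simp: merge_def)
    have nz': "fdet r (\<lambda>i j. F (merge ?J (?xs i) (ys j))) \<noteq> 0"
      using nz fdet_cong[of r "\<lambda>i j. F (merge ?J (?xs i) (ys j))" "\<lambda>i j. t i (ys j)"] base by auto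
    have z': "fdet (Suc r) (\<lambda>i j. F (merge ?J (if i < r then ?xs i else ?x) (if j < r then ys j else ?y))) = 0"
    proof (rule maximal)
      show "?J \<subseteq> {..<p}" using J aJ by auto
      show "card ?J \<le> Suc r" using J(2) fin(1) by (simp add: card_insert_if)
    qed
    have G': "(\<Sum>u<r. F (merge ?J (?xs i) (ys u)) * G u j) = (if i = j then 1 else 0)"
      if "i < r" "j < r" for i j
      using G[OF that] base by simp
    from bordered_minor[of r "\<lambda>x y. F (merge ?J x y)" ?xs ys ?x ?y, OF nz' z' G']
    have "F (merge ?J ?x ?y) =
        (\<Sum>u<r. (\<Sum>w<r. F (merge ?J ?x (ys w)) * G w u) * F (merge ?J (?xs u) ?y))"
      by simp
    moreover have "F (merge ?J ?x ?y) = Z s (a # A) y"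
      unfolding Z_def using aJ by (intro arg_cong[of _ _ F]) (auto simp: merge_def)
    moreover have "merge ?J ?x (ys w) = merge J (xs s) ((ys w)(a := y a))" for w
      using aJ by (auto simp: merge_def)
    moreover have "F (merge ?J (?xs u) ?y) = Z u A y" for u
      unfolding Z_def using aJ a(2) by (intro arg_cong[of _ _ F]) (auto simp: merge_def)
    ultimately show ?thesis by (simp add: X_def)
  qed
  have chain: "Z s A y = (\<Sum>u<r. mat_chain r X A y s u * Z u [] y)"
    if "set A \<subseteq> set qs" "distinct A" "s < r" for s A y
    using that
  proof (induction A arbitrary: s)
    case Nil
    have "(\<Sum>u<r. mat_chain r X [] y s u * Z u [] y) = (\<Sum>u<r. if u = s then Z u [] y else 0)"
      by (intro sum.cong) auto
    then show ?case using Nil by simp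
  next
    case (Cons a A)
    have "Z s (a # A) y = (\<Sum>u<r. X a (y a) s u * Z u A y)"
      using Cons.prems by (intro peel) auto
    also have "\<dots> = (\<Sum>u<r. X a (y a) s u * (\<Sum>v<r. mat_chain r X A y u v * Z v [] y))"
      using Cons by (intro sum.cong) auto
    also have "\<dots> = (\<Sum>v<r. \<Sum>u<r. X a (y a) s u * mat_chain r X A y u v * Z v [] y)"
      unfolding sum_distrib_left by (subst sum.swap) (simp add: mult.assoc)
    also have "\<dots> = (\<Sum>v<r. mat_chain r X (a # A) y s v * Z v [] y)"
      by (simp add: sum_distrib_right)
    finally show ?case .
  qed
  have F_eq: "F y = (\<Sum>s<r. (\<Sum>w<r. F (merge J y (ys w)) * G w s) * Z s qs y)" for y
  proof -
    have z': "fdet (Suc r) (\<lambda>i j. F (merge J (if i < r then xs i else y) (if j < r then ys j else y))) = 0"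
      using J by (intro maximal) auto
    have "F (merge J (xs s) y) = Z s qs y" for s
      unfolding Z_def using set_qs by (intro dep) (auto simp: merge_def)
    moreover have "merge J y y = y" by (auto simp: merge_def)
    ultimately show ?thesis
      using bordered_minor[of r "\<lambda>x y. F (merge J x y)" xs ys y y, OF nz[unfolded t_def] z' G[unfolded t_def]]
      by simp
  qed
  \<comment> \<open>\<open>rd\<close> recovers a point, on the head, from the list of its values there.\<close>
  define rd where "rd vs b = the (map_of (zip hs vs) b)" for vs :: "(nat \<Rightarrow> 'k) list" and b
  have rd: "rd (map y hs) b = y b" if "b \<in> J \<union> S" for y b
    using that set_hs by (simp add: rd_def map_of_zip_map)
  define B where "B s u vs = (\<Sum>w<r. F (merge J (rd vs) (ys w)) * G w s) * Z u [] (rd vs)" for s u vs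
  have B: "B s u (map y hs) = (\<Sum>w<r. F (merge J y (ys w)) * G w s) * Z u [] y" for s u y
  proof -
    have "merge J (rd (map y hs)) z = merge J y z" for z
      using rd by (auto simp: merge_def)
    moreover have "Z u [] (rd (map y hs)) = Z u [] y"
      unfolding Z_def using rd by (intro arg_cong[of _ _ F] arg_cong[of _ _ "merge J (xs u)"]) auto
    ultimately show ?thesis by (simp add: B_def)
  qed
  have F_B: "F y = (\<Sum>s<r. \<Sum>u<r. B s u (map y hs) * mat_chain r X qs y s u)" for y
  proof -
    have "F y = (\<Sum>s<r. (\<Sum>w<r. F (merge J y (ys w)) * G w s) * (\<Sum>u<r. mat_chain r X qs y s u * Z u [] y))"
      unfolding F_eq[of y] using chain[of qs] dist by (intro sum.cong) auto
    also have "\<dots> = (\<Sum>s<r. \<Sum>u<r. B s u (map y hs) * mat_chain r X qs y s u)"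
      unfolding sum_distrib_left B by (intro sum.cong refl) (simp only: mult_ac)
    finally show ?thesis .
  qed
  have "\<forall>a\<in>set qs. \<forall>s<r. \<forall>u<r. X a (l a) s u = (if s = u then 1 else 0)"
    using X_id by blast
  moreover have "\<forall>y. F y = (\<Sum>s<r. \<Sum>u<r. B s u (map y hs) * mat_chain r X qs y s u)"
    using F_B by (rule allI)
  ultimately show ?thesis
    using \<open>r \<le> k\<close> dist set_all len_hs
    by (intro exI[of _ r] exI[of _ hs] exI[of _ qs] exI[of _ l] exI[of _ B] exI[of _ X] conjI)
qed

lemma mat_chain_filter:
  assumes "\<forall>a\<in>set qs. \<not> P a \<longrightarrow> (\<forall>s<r. \<forall>u<r. X a (y a) s u = (if s = u then 1 else 0))"
    and "s < r"
  shows "mat_chain r X qs y s t = mat_chain r X (filter P qs) y s t"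
  using assms
proof (induction qs arbitrary: s)
  case (Cons a qs)
  have IH: "mat_chain r X qs y u t = mat_chain r X (filter P qs) y u t" if "u < r" for u
    using Cons.prems that by (intro Cons.IH) simp_all
  show ?case
  proof (cases "P a")
    case True
    then show ?thesis using IH by simp
  next
    case False
    then have "X a (y a) s u = (if s = u then 1 else 0)" if "u < r" for u
      using Cons.prems that by simp
    then have "mat_chain r X (a # qs) y s t = (\<Sum>u<r. if u = s then mat_chain r X qs y u t else 0)"
      unfolding mat_chain.simps by (intro sum.cong refl) auto
    also have "\<dots> = mat_chain r X qs y s t" using Cons.prems(2) by simp
    finally show ?thesis using False IH Cons.prems(2) by simp
  qed
qed simp

lemma subseq_set_subset: "subseq xs ys \<Longrightarrow> set xs \<subseteq> set ys"
  by (induction rule: list_emb.induct) auto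

lemma subseq_distinct_filter:
  "subseq xs ys \<Longrightarrow> distinct ys \<Longrightarrow> xs = filter (\<lambda>a. a \<in> set xs) ys"
proof (induction rule: list_emb.induct)
  case (list_emb_Cons xs ys y)
  have "y \<notin> set xs"
    using subseq_set_subset[OF list_emb_Cons.hyps] list_emb_Cons.prems by auto
  then show ?case
    using list_emb_Cons.IH list_emb_Cons.prems by simp
next
  case (list_emb_Cons2 x y xs ys)
  have "filter (\<lambda>a. a \<in> set (x # xs)) ys = filter (\<lambda>a. a \<in> set xs) ys"
    using list_emb_Cons2.hyps list_emb_Cons2.prems by (intro filter_cong) auto
  then show ?case
    using list_emb_Cons2.hyps list_emb_Cons2.IH list_emb_Cons2.prems by simp
qed simp

section \<open>Polynomial functions of bounded degree\<close>

definition monom_eval :: "('v \<Rightarrow>\<^sub>0 nat) \<Rightarrow> ('v \<Rightarrow> 'k) \<Rightarrow> 'k::comm_semiring_1" where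
  "monom_eval m a = (\<Prod>v\<in>Poly_Mapping.keys m. a v ^ Poly_Mapping.lookup m v)"

definition monom_degree :: "('v \<Rightarrow>\<^sub>0 nat) \<Rightarrow> nat" where
  "monom_degree m = (\<Sum>v\<in>Poly_Mapping.keys m. Poly_Mapping.lookup m v)"

definition monoms :: "'v set \<Rightarrow> nat \<Rightarrow> (('v \<Rightarrow> 'k) \<Rightarrow> 'k::comm_ring_1) set" where
  "monoms V d = {monom_eval m | m. Poly_Mapping.keys m \<subseteq> V \<and> monom_degree m \<le> d}"

text \<open>
  Polynomial functions of degree at most \<open>d\<close> in the variables \<open>V\<close>. Since only values matter below,
  polynomials are replaced by the functions they induce; the two lemmas \<open>mpoly_eval_in_poly_maps\<close> and
  \<open>poly_maps_imp_mpoly\<close> translate back and forth without changing the bound on the degree.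
\<close>

definition poly_maps :: "'v set \<Rightarrow> nat \<Rightarrow> (('v \<Rightarrow> 'k) \<Rightarrow> 'k::comm_ring_1) set" where
  "poly_maps V d = fspan (monoms V d)"

lemma monom_eval_add: "monom_eval (m + m') a = monom_eval m a * monom_eval m' a"
proof -
  let ?S = "Poly_Mapping.keys m \<union> Poly_Mapping.keys m'"
  have sup: "monom_eval n a = (\<Prod>v\<in>?S. a v ^ Poly_Mapping.lookup n v)"
    if "Poly_Mapping.keys n \<subseteq> ?S" for n
    unfolding monom_eval_def using that
    by (intro prod.mono_neutral_left) (auto simp: in_keys_iff)
  show ?thesis
    using sup[of m] sup[of m'] sup[of "m + m'"] Poly_Mapping.keys_add[of m m']
    by (simp add: lookup_add power_add prod.distrib)
qed

lemma monom_degree_add: "monom_degree (m + m') = monom_degree m + monom_degree m'"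
proof -
  let ?S = "Poly_Mapping.keys m \<union> Poly_Mapping.keys m'"
  have sup: "monom_degree n = (\<Sum>v\<in>?S. Poly_Mapping.lookup n v)"
    if "Poly_Mapping.keys n \<subseteq> ?S" for n
    unfolding monom_degree_def using that
    by (intro sum.mono_neutral_left) (auto simp: in_keys_iff)
  show ?thesis
    using sup[of m] sup[of m'] sup[of "m + m'"] Poly_Mapping.keys_add[of m m']
    by (simp add: lookup_add sum.distrib)
qed

lemma mpoly_eval_superset:
  assumes "finite A" "Poly_Mapping.keys f \<subseteq> A"
  shows "mpoly_eval f a = (\<Sum>m\<in>A. Poly_Mapping.lookup f m * monom_eval m a)"
  unfolding mpoly_eval_def monom_eval_def using assms
  by (intro sum.mono_neutral_left) (auto simp: in_keys_iff)

lemma mpoly_eval_add: "mpoly_eval (f + g) a = mpoly_eval f a + mpoly_eval g a"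
proof -
  let ?S = "Poly_Mapping.keys f \<union> Poly_Mapping.keys g"
  have "mpoly_eval h a = (\<Sum>m\<in>?S. Poly_Mapping.lookup h m * monom_eval m a)"
    if "Poly_Mapping.keys h \<subseteq> ?S" for h
    using that by (intro mpoly_eval_superset) auto
  from this[of f] this[of g] this[of "f + g"] show ?thesis
    using Poly_Mapping.keys_add[of f g]
    by (simp add: lookup_add distrib_right sum.distrib)
qed

lemma mpoly_eval_single: "mpoly_eval (Poly_Mapping.single m c) a = c * monom_eval m a"
  using mpoly_eval_superset[of "{m}" "Poly_Mapping.single m c" a] by simp

lemma mpoly_degree_le_iff:
  "mpoly_degree f \<le> d \<longleftrightarrow> (\<forall>m\<in>Poly_Mapping.keys f. monom_degree m \<le> d)"
  unfolding mpoly_degree_def monom_degree_def by (subst Max_le_iff) auto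

lemma mpoly_eval_in_poly_maps:
  assumes "\<And>m. m \<in> Poly_Mapping.keys f \<Longrightarrow> Poly_Mapping.keys m \<subseteq> V" "mpoly_degree f \<le> d"
  shows "mpoly_eval f \<in> poly_maps V d"
proof -
  have "(\<lambda>a. \<Sum>m\<in>Poly_Mapping.keys f. Poly_Mapping.lookup f m * monom_eval m a) \<in> poly_maps V d"
    unfolding poly_maps_def using assms
    by (intro fspan_sum fspan_scale fspan_base) (auto simp: monoms_def mpoly_degree_le_iff)
  then show ?thesis
    by (simp add: mpoly_eval_def[abs_def] monom_eval_def)
qed

lemma poly_maps_imp_mpoly:
  assumes "g \<in> poly_maps V d"
  shows "\<exists>f. (\<forall>m\<in>Poly_Mapping.keys f. Poly_Mapping.keys m \<subseteq> V) \<and> mpoly_degree f \<le> d \<and> mpoly_eval f = g"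
  using assms unfolding poly_maps_def
proof (induction rule: fspan.induct)
  case zero
  then show ?case by (intro exI[of _ 0]) (auto simp: mpoly_eval_def mpoly_degree_def)
next
  case (step b g c)
  then obtain m f where m: "b = monom_eval m" "Poly_Mapping.keys m \<subseteq> V" "monom_degree m \<le> d"
    and f: "\<forall>m\<in>Poly_Mapping.keys f. Poly_Mapping.keys m \<subseteq> V" "mpoly_degree f \<le> d" "mpoly_eval f = g"
    unfolding monoms_def by auto
  let ?f = "Poly_Mapping.single m c + f"
  have keys: "Poly_Mapping.keys ?f \<subseteq> insert m (Poly_Mapping.keys f)"
    using Poly_Mapping.keys_add[of "Poly_Mapping.single m c" f] by (auto split: if_splits)
  have "mpoly_eval ?f = (\<lambda>a. c * b a + g a)"
    using m f by (auto simp: fun_eq_iff mpoly_eval_add mpoly_eval_single)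
  moreover have "mpoly_degree ?f \<le> d"
    using keys f m unfolding mpoly_degree_le_iff by auto
  moreover have "\<forall>m\<in>Poly_Mapping.keys ?f. Poly_Mapping.keys m \<subseteq> V"
    using keys f m by auto
  ultimately show ?case by blast
qed

lemma poly_maps_const: "(\<lambda>_. c) \<in> poly_maps V d"
proof -
  have "monom_eval 0 \<in> monoms V d"
    unfolding monoms_def by (auto simp: monom_degree_def intro!: exI[of _ 0])
  from fspan_scale[OF fspan_base[OF this], of c] show ?thesis
    by (simp add: poly_maps_def monom_eval_def)
qed

lemma poly_maps_var:
  assumes "v \<in> V"
  shows "(\<lambda>a. a v) \<in> poly_maps V 1"
proof -
  have in_monoms: "monom_eval (Poly_Mapping.single v 1) \<in> monoms V 1"
    unfolding monoms_def using assms by (auto simp: monom_degree_def intro!: exI[of _ "Poly_Mapping.single v 1"])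
  have eq: "monom_eval (Poly_Mapping.single v 1) = (\<lambda>a. a v)"
    by (simp add: monom_eval_def fun_eq_iff)
  show ?thesis
    using fspan_base[OF in_monoms] unfolding poly_maps_def eq .
qed

lemma poly_maps_scale: "g \<in> poly_maps V d \<Longrightarrow> (\<lambda>a. c * g a) \<in> poly_maps V d"
  unfolding poly_maps_def by (rule fspan_scale)

lemma poly_maps_sum: "(\<And>i. i \<in> I \<Longrightarrow> f i \<in> poly_maps V d) \<Longrightarrow> (\<lambda>a. \<Sum>i\<in>I. f i a) \<in> poly_maps V d"
  unfolding poly_maps_def by (rule fspan_sum)

lemma poly_maps_mono: "f \<in> poly_maps V d \<Longrightarrow> d \<le> e \<Longrightarrow> f \<in> poly_maps V e"
  unfolding poly_maps_def by (erule fspan_subset) (auto simp: monoms_def intro!: fspan_base)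

lemma poly_maps_mult:
  assumes "f \<in> poly_maps V d" "g \<in> poly_maps V e"
  shows "(\<lambda>a. f a * g a) \<in> poly_maps V (d + e)"
  using assms unfolding poly_maps_def
proof (rule fspan_mult)
  fix b c :: "('a \<Rightarrow> 'b) \<Rightarrow> 'b" assume "b \<in> monoms V d" "c \<in> monoms V e"
  then obtain m m' where m: "b = monom_eval m" "Poly_Mapping.keys m \<subseteq> V" "monom_degree m \<le> d"
     "c = monom_eval m'" "Poly_Mapping.keys m' \<subseteq> V" "monom_degree m' \<le> e"
    unfolding monoms_def by auto
  have "(\<lambda>a. b a * c a) = monom_eval (m + m')"
    using m by (simp add: fun_eq_iff monom_eval_add)
  moreover have "Poly_Mapping.keys (m + m') \<subseteq> V"
    using m Poly_Mapping.keys_add[of m m'] by blast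
  moreover have "monom_degree (m + m') \<le> d + e"
    using m by (simp add: monom_degree_add)
  ultimately show "(\<lambda>a. b a * c a) \<in> fspan (monoms V (d + e))"
    unfolding monoms_def by (intro fspan_base) blast
qed

lemma poly_maps_prod:
  "(\<And>i. i \<in> I \<Longrightarrow> f i \<in> poly_maps V (d i)) \<Longrightarrow> (\<lambda>a. \<Prod>i\<in>I. f i a) \<in> poly_maps V (\<Sum>i\<in>I. d i)"
  by (induction I rule: infinite_finite_induct) (auto intro: poly_maps_const poly_maps_mult)

lemma poly_maps_power:
  assumes "f \<in> poly_maps V d"
  shows "(\<lambda>a. f a ^ n) \<in> poly_maps V (n * d)"
proof (induction n)
  case (Suc n)
  then show ?case using poly_maps_mult[OF assms Suc] by simp
qed (simp add: poly_maps_const)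

lemma poly_maps_linear_substitution:
  assumes g: "g \<in> poly_maps V d"
    and \<phi>: "\<And>v. v \<in> V \<Longrightarrow> (\<lambda>a. \<phi> a v) \<in> poly_maps W 1"
  shows "(\<lambda>a. g (\<phi> a)) \<in> poly_maps W d"
proof -
  have "(\<lambda>a. 1 * g (\<phi> a)) \<in> fspan (monoms W d)"
    using g unfolding poly_maps_def
  proof (rule fspan_transform)
    fix b :: "('a \<Rightarrow> 'b) \<Rightarrow> 'b" assume "b \<in> monoms V d"
    then obtain m where m: "b = monom_eval m" "Poly_Mapping.keys m \<subseteq> V" "monom_degree m \<le> d"
      unfolding monoms_def by auto
    have "(\<lambda>a. \<Prod>v\<in>Poly_Mapping.keys m. \<phi> a v ^ Poly_Mapping.lookup m v) \<in>
        poly_maps W (\<Sum>v\<in>Poly_Mapping.keys m. Poly_Mapping.lookup m v * 1)"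
      using m \<phi> by (intro poly_maps_prod poly_maps_power) auto
    then have "(\<lambda>a. b (\<phi> a)) \<in> poly_maps W d"
      using m by (intro poly_maps_mono[of _ W "monom_degree m" d])
        (simp_all add: monom_eval_def monom_degree_def)
    then show "(\<lambda>a. 1 * b (\<phi> a)) \<in> fspan (monoms W d)"
      by (simp add: poly_maps_def)
  qed
  then show ?thesis by (simp add: poly_maps_def)
qed

text \<open>
  Here \<open>A\<close> is an arbitrary algebra of functions; the degree is lost. It serves to express the
  polynomials in tensor entries through the letters of a word.
\<close>

lemma poly_maps_substitution:
  assumes g: "g \<in> poly_maps V d"
    and const: "\<And>c. (\<lambda>_. c) \<in> A"
    and add: "\<And>f g. f \<in> A \<Longrightarrow> g \<in> A \<Longrightarrow> (\<lambda>a. f a + g a) \<in> A"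
    and mult: "\<And>f g. f \<in> A \<Longrightarrow> g \<in> A \<Longrightarrow> (\<lambda>a. f a * g a) \<in> A"
    and \<phi>: "\<And>v. v \<in> V \<Longrightarrow> (\<lambda>a. \<phi> a v) \<in> A"
  shows "(\<lambda>a. g (\<phi> a)) \<in> A"
  using g unfolding poly_maps_def
proof (induction rule: fspan.induct)
  case zero
  show ?case by (rule const)
next
  case (step b g c)
  then obtain m where m: "b = monom_eval m" "Poly_Mapping.keys m \<subseteq> V"
    unfolding monoms_def by auto
  have pow: "(\<lambda>a. f a ^ n) \<in> A" if "f \<in> A" for f and n :: nat
    using that by (induction n) (auto intro: const mult)
  have prod: "(\<lambda>a. \<Prod>i\<in>I. f i a) \<in> A" if "\<And>i. i \<in> I \<Longrightarrow> f i \<in> A" for I and f :: "'a \<Rightarrow> _"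
    using that by (induction I rule: infinite_finite_induct) (auto intro: const mult)
  have "(\<lambda>a. b (\<phi> a)) \<in> A"
    unfolding m(1) monom_eval_def using m(2) \<phi> by (intro prod pow) auto
  then show ?case by (intro add mult const step.IH)
qed

section \<open>Tensors as multilinear forms, and natural maps\<close>

lemma tensor_positions_Nil: "tensor_positions [] = {[]}"
  by (auto simp: tensor_positions_def)

lemma Cons_in_tensor_positions:
  "v # w \<in> tensor_positions (n # ns) \<longleftrightarrow> v < n \<and> w \<in> tensor_positions ns"
  by (auto simp: tensor_positions_def All_less_Suc2)

lemma tensor_positions_Cons:
  "tensor_positions (n # ns) = (\<lambda>(v, w). v # w) ` ({..<n} \<times> tensor_positions ns)"
proof (intro equalityI subsetI)
  fix u assume u: "u \<in> tensor_positions (n # ns)"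
  then obtain v w where "u = v # w"
    by (cases u) (auto simp: tensor_positions_def)
  then show "u \<in> (\<lambda>(v, w). v # w) ` ({..<n} \<times> tensor_positions ns)"
    using u Cons_in_tensor_positions by force
qed (auto simp: Cons_in_tensor_positions)

lemma finite_tensor_positions: "finite (tensor_positions ns)"
  by (induction ns) (auto simp: tensor_positions_Nil tensor_positions_Cons)

lemma length_tensor_position: "w \<in> tensor_positions ns \<Longrightarrow> length w = length ns"
  by (simp add: tensor_positions_def)

lemma tensor_positions_replicate:
  "w \<in> tensor_positions (replicate p k) \<longleftrightarrow> length w = p \<and> (\<forall>b<p. w ! b < k)"
  by (auto simp: tensor_positions_def)

lemma sum_tensor_positions_Cons:
  "(\<Sum>u\<in>tensor_positions (n # ns). f u) = (\<Sum>v<n. \<Sum>w\<in>tensor_positions ns. f (v # w))"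
  unfolding tensor_positions_Cons
  by (subst sum.reindex) (auto simp: inj_on_def sum.cartesian_product case_prod_beta)

lemma sum_tensor_positions_prod:
  fixes f :: "nat \<Rightarrow> nat \<Rightarrow> 'k::comm_ring_1"
  shows "(\<Sum>w\<in>tensor_positions ns. \<Prod>j<length ns. f j (w ! j)) = (\<Prod>j<length ns. \<Sum>v<ns ! j. f j v)"
proof (induction ns arbitrary: f)
  case (Cons n ns)
  have "(\<Sum>w\<in>tensor_positions (n # ns). \<Prod>j<length (n # ns). f j (w ! j)) =
      (\<Sum>v<n. f 0 v * (\<Sum>w\<in>tensor_positions ns. \<Prod>j<length ns. f (Suc j) (w ! j)))"
    by (simp add: sum_tensor_positions_Cons prod.lessThan_Suc_shift sum_distrib_left del: prod.lessThan_Suc)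
  then show ?case
    unfolding Cons.IH[of "\<lambda>j. f (Suc j)"]
    by (simp add: prod.lessThan_Suc_shift sum_distrib_right del: prod.lessThan_Suc)
qed (simp add: tensor_positions_Nil)

text \<open>
  The multilinear form of a tensor: its simultaneous contraction with the vectors \<open>y 0, y 1, \<dots>\<close>.
  Entries, slices and contractions of the tensor all become values of this form.
\<close>

definition tensor_form :: "nat list \<Rightarrow> (nat list \<Rightarrow> 'k::field) \<Rightarrow> (nat \<Rightarrow> nat \<Rightarrow> 'k) \<Rightarrow> 'k" where
  "tensor_form ns T y = (\<Sum>w\<in>tensor_positions ns. T w * (\<Prod>j<length ns. y j (w ! j)))"

definition unit_vector :: "nat \<Rightarrow> nat \<Rightarrow> 'k::field" where
  "unit_vector i v = (if v = i then 1 else 0)"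

lemma tensor_form_cong:
  "(\<And>a. a < length ns \<Longrightarrow> y a = z a) \<Longrightarrow> tensor_form ns T y = tensor_form ns T z"
  unfolding tensor_form_def by (intro sum.cong) auto

lemma tensor_form_unit:
  assumes "w \<in> tensor_positions ns"
  shows "tensor_form ns T (\<lambda>a. unit_vector (w ! a)) = T w"
proof -
  have "(\<Prod>j<length ns. unit_vector (w ! j) (u ! j) :: 'a) = (if u = w then 1 else 0)"
    if u: "u \<in> tensor_positions ns" for u
  proof (cases "u = w")
    case False
    then obtain j where "j < length ns" "u ! j \<noteq> w ! j"
      using u assms by (metis length_tensor_position nth_equalityI)
    then have "(\<Prod>j<length ns. unit_vector (w ! j) (u ! j) :: 'a) = 0"
      by (intro prod_zero) (auto simp: unit_vector_def)
    then show ?thesis using False by simp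
  qed (simp add: unit_vector_def)
  then have "tensor_form ns T (\<lambda>a. unit_vector (w ! a)) =
      (\<Sum>u\<in>tensor_positions ns. if u = w then T u else 0)"
    unfolding tensor_form_def by (intro sum.cong) auto
  then show ?thesis
    using assms finite_tensor_positions by simp
qed

lemma tensor_form_product:
  assumes "\<And>w. w \<in> tensor_positions ns \<Longrightarrow> T w = (\<Prod>j<length ns. x j (w ! j))"
  shows "tensor_form ns T y = (\<Prod>j<length ns. \<Sum>v<ns ! j. x j v * y j v)"
proof -
  have "tensor_form ns T y = (\<Sum>w\<in>tensor_positions ns. \<Prod>j<length ns. x j (w ! j) * y j (w ! j))"
    unfolding tensor_form_def using assms by (intro sum.cong) (auto simp: prod.distrib)
  then show ?thesis by (simp only: sum_tensor_positions_prod[of "\<lambda>j v. x j v * y j v"])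
qed

lemma tensor_form_sum:
  assumes "\<And>w. w \<in> tensor_positions ns \<Longrightarrow> T w = (\<Sum>t\<in>I. \<tau> t w)"
  shows "tensor_form ns T y = (\<Sum>t\<in>I. tensor_form ns (\<tau> t) y)"
proof -
  have "tensor_form ns T y = (\<Sum>w\<in>tensor_positions ns. \<Sum>t\<in>I. \<tau> t w * (\<Prod>j<length ns. y j (w ! j)))"
    unfolding tensor_form_def using assms by (intro sum.cong) (auto simp: sum_distrib_right)
  then show ?thesis unfolding tensor_form_def by (subst (asm) sum.swap)
qed

lemma tensor_form_polynomial_along_line:
  "polynomial_function (\<lambda>e. tensor_form ns T (\<lambda>a v. y a v + e * d a v))"
  unfolding tensor_form_def
  by (intro polynomial_function_sum polynomial_function_mult polynomial_function_const
      polynomial_function_prod polynomial_function_linear)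

lemma Inf_enat_le_iff: "Inf (enat ` A) \<le> enat k \<longleftrightarrow> (\<exists>r\<in>A. r \<le> k)"
proof
  assume le: "Inf (enat ` A) \<le> enat k"
  then have "A \<noteq> {}" by (auto simp: top_enat_def)
  then have "Inf (enat ` A) \<in> enat ` A"
    unfolding Inf_enat_def by (auto intro: LeastI)
  then show "\<exists>r\<in>A. r \<le> k" using le by auto
next
  assume "\<exists>r\<in>A. r \<le> k"
  then obtain r where "r \<in> A" "r \<le> k" by blast
  then show "Inf (enat ` A) \<le> enat k"
    by (meson Inf_lower2 enat_ord_simps(1) image_eqI)
qed

lemma tensor_rank_le_iff:
  "tensor_rank ns T \<le> enat k \<longleftrightarrow> (\<exists>r\<le>k. sum_of_pure_tensors ns r T)"
  unfolding tensor_rank_def Inf_enat_le_iff by auto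

definition vanishing :: "nat \<Rightarrow> nat list \<Rightarrow> ((nat list \<Rightarrow> 'k::field) \<Rightarrow> 'k) \<Rightarrow> bool" where
  "vanishing k ns g \<longleftrightarrow> (\<forall>\<tau>\<in>tensor_space ns. tensor_rank ns \<tau> \<le> enat k \<longrightarrow> g \<tau> = 0)"

lemma border_rank_le_iff:
  "border_rank ns \<omega> \<le> enat k \<longleftrightarrow>
     (\<forall>f\<in>tensor_polys ns. vanishing k ns (mpoly_eval f) \<longrightarrow> mpoly_eval f \<omega> = 0)"
proof -
  have "vanishing r ns g" if "vanishing k ns g" "r \<le> k" for r and g :: "(nat list \<Rightarrow> 'a) \<Rightarrow> 'a"
    using that unfolding vanishing_def by (meson enat_ord_simps(1) order_trans)
  then show ?thesis
    unfolding border_rank_def Inf_enat_le_iff vanishing_def[symmetric] by auto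
qed

text \<open>
  The set \<open>X\<^sub>d(ns)\<close> of the introduction.
\<close>

definition rank_approximation :: "nat \<Rightarrow> nat \<Rightarrow> nat list \<Rightarrow> (nat list \<Rightarrow> 'k::field) set" where
  "rank_approximation k d ns =
     {\<omega> \<in> tensor_space ns. \<forall>g\<in>poly_maps (tensor_positions ns) d. vanishing k ns g \<longrightarrow> g \<omega> = 0}"

lemma rank_approximation_antimono: "d \<le> e \<Longrightarrow> rank_approximation k e ns \<subseteq> rank_approximation k d ns"
  unfolding rank_approximation_def using poly_maps_mono by blast

text \<open>
  The maps that relate tensors of different formats: they do not increase the rank, and composition with
  them does not raise the degree of polynomials.
\<close>

definition natural_map :: "nat list \<Rightarrow> nat list \<Rightarrow> ((nat list \<Rightarrow> 'k::field) \<Rightarrow> nat list \<Rightarrow> 'k) \<Rightarrow> bool" where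
  "natural_map ns ns' \<phi> \<longleftrightarrow>
     (\<exists>\<Phi>. \<forall>T. \<phi> T = (\<lambda>w'\<in>tensor_positions ns'. \<Sum>w\<in>tensor_positions ns. \<Phi> w' w * T w)) \<and>
     (\<forall>T. pure_tensor ns T \<longrightarrow> pure_tensor ns' (\<phi> T))"

lemma natural_map_rank:
  assumes nat: "natural_map ns ns' \<phi>" and rank: "tensor_rank ns T \<le> enat k"
  shows "\<phi> T \<in> tensor_space ns'" "tensor_rank ns' (\<phi> T) \<le> enat k"
proof -
  obtain \<Phi> where \<Phi>: "\<And>T. \<phi> T = (\<lambda>w'\<in>tensor_positions ns'. \<Sum>w\<in>tensor_positions ns. \<Phi> w' w * T w)"
    and pure: "\<And>T. pure_tensor ns T \<Longrightarrow> pure_tensor ns' (\<phi> T)"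
    using nat unfolding natural_map_def by blast
  show "\<phi> T \<in> tensor_space ns'"
    by (simp add: \<Phi> tensor_space_def)
  obtain r \<tau> where r: "r \<le> k" "\<And>t. t < r \<Longrightarrow> pure_tensor ns (\<tau> t)"
    and T: "\<And>w. w \<in> tensor_positions ns \<Longrightarrow> T w = (\<Sum>t<r. \<tau> t w)"
    using rank unfolding tensor_rank_le_iff sum_of_pure_tensors_def by blast
  have "\<phi> T w' = (\<Sum>t<r. \<phi> (\<tau> t) w')" if "w' \<in> tensor_positions ns'" for w'
  proof -
    have "\<phi> T w' = (\<Sum>w\<in>tensor_positions ns. \<Sum>t<r. \<Phi> w' w * \<tau> t w)"
      using that T by (simp add: \<Phi> sum_distrib_left)
    also have "\<dots> = (\<Sum>t<r. \<Sum>w\<in>tensor_positions ns. \<Phi> w' w * \<tau> t w)"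
      by (rule sum.swap)
    finally show ?thesis using that by (simp add: \<Phi>)
  qed
  then show "tensor_rank ns' (\<phi> T) \<le> enat k"
    unfolding tensor_rank_le_iff sum_of_pure_tensors_def
    using r pure by (intro exI[of _ r] conjI exI[of _ "\<lambda>t. \<phi> (\<tau> t)"]) auto
qed

lemma natural_map_vanishing:
  assumes "natural_map ns ns' \<phi>" "vanishing k ns' g"
  shows "vanishing k ns (\<lambda>T. g (\<phi> T))"
  using natural_map_rank[OF assms(1)] assms(2) unfolding vanishing_def by blast

lemma natural_map_poly_maps:
  assumes "natural_map ns ns' \<phi>" "g \<in> poly_maps (tensor_positions ns') d"
  shows "(\<lambda>T. g (\<phi> T)) \<in> poly_maps (tensor_positions ns) d"
  using assms(2)
proof (rule poly_maps_linear_substitution)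
  fix w' assume w': "w' \<in> tensor_positions ns'"
  obtain \<Phi> where "\<And>T. \<phi> T = (\<lambda>w'\<in>tensor_positions ns'. \<Sum>w\<in>tensor_positions ns. \<Phi> w' w * T w)"
    using assms(1) unfolding natural_map_def by blast
  then have "(\<lambda>T. \<phi> T w') = (\<lambda>T. \<Sum>w\<in>tensor_positions ns. \<Phi> w' w * T w)"
    using w' by simp
  also have "\<dots> \<in> poly_maps (tensor_positions ns) 1"
    by (intro poly_maps_sum poly_maps_scale poly_maps_var)
  finally show "(\<lambda>T. \<phi> T w') \<in> poly_maps (tensor_positions ns) 1" .
qed

text \<open>
  All natural maps that occur below have this form: for every position \<open>w'\<close> of the target, the form of
  \<open>T\<close> is evaluated at vectors of which the \<open>a\<close>-th depends on the single index \<open>w' ! \<tau> a\<close> only. The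
  contraction with a fixed vector at \<open>a\<close> is the case where \<open>Y a\<close> is constant; \<open>\<tau> a\<close> is then
  arbitrary, but has to exist.
\<close>

definition substitution_map ::
    "nat list \<Rightarrow> nat list \<Rightarrow> (nat \<Rightarrow> nat) \<Rightarrow> (nat \<Rightarrow> nat \<Rightarrow> nat \<Rightarrow> 'k::field) \<Rightarrow> (nat list \<Rightarrow> 'k) \<Rightarrow> nat list \<Rightarrow> 'k" where
  "substitution_map ns ns' \<tau> Y T =
     (\<lambda>w'\<in>tensor_positions ns'. tensor_form ns T (\<lambda>a. Y a (w' ! \<tau> a)))"

text \<open>
  A pure tensor goes to a product over the factors \<open>a\<close> of the source; collecting the factors with
  \<open>\<tau> a = b\<close> turns it into a product over the factors \<open>b\<close> of the target.
\<close>

lemma natural_substitution_map: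
  assumes \<tau>: "\<And>a. a < length ns \<Longrightarrow> \<tau> a < length ns'"
  shows "natural_map ns ns' (substitution_map ns ns' \<tau> Y)"
  unfolding natural_map_def
proof (intro conjI allI impI exI)
  fix T :: "nat list \<Rightarrow> 'a"
  show "substitution_map ns ns' \<tau> Y T = (\<lambda>w'\<in>tensor_positions ns'. \<Sum>w\<in>tensor_positions ns.
      (\<Prod>j<length ns. Y j (w' ! \<tau> j) (w ! j)) * T w)"
    unfolding substitution_map_def tensor_form_def by (simp add: mult.commute)
next
  fix T :: "nat list \<Rightarrow> 'a" assume "pure_tensor ns T"
  then obtain x where x: "\<And>w. w \<in> tensor_positions ns \<Longrightarrow> T w = (\<Prod>j<length ns. x j (w ! j))"
    unfolding pure_tensor_def by blast
  let ?z = "\<lambda>b i. \<Prod>a\<in>{a \<in> {..<length ns}. \<tau> a = b}. \<Sum>v<ns ! a. x a v * Y a i v"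
  have "substitution_map ns ns' \<tau> Y T w' = (\<Prod>b<length ns'. ?z b (w' ! b))"
    if w': "w' \<in> tensor_positions ns'" for w'
  proof -
    have "substitution_map ns ns' \<tau> Y T w' =
        (\<Prod>a<length ns. \<Sum>v<ns ! a. x a v * Y a (w' ! \<tau> a) v)"
      using w' tensor_form_product[of ns T x, OF x] by (simp add: substitution_map_def)
    also have "\<dots> = (\<Prod>b<length ns'. \<Prod>a\<in>{a \<in> {..<length ns}. \<tau> a = b}.
        \<Sum>v<ns ! a. x a v * Y a (w' ! \<tau> a) v)"
      using \<tau> by (intro prod.group[symmetric]) auto
    also have "\<dots> = (\<Prod>b<length ns'. ?z b (w' ! b))"
      by (intro prod.cong refl) auto
    finally show ?thesis .
  qed
  moreover have "substitution_map ns ns' \<tau> Y T \<in> tensor_space ns'"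
    by (simp add: substitution_map_def tensor_space_def)
  ultimately show "pure_tensor ns' (substitution_map ns ns' \<tau> Y T)"
    unfolding pure_tensor_def by (intro conjI exI[of _ ?z]) auto
qed

text \<open>
  The flattening of a pure tensor is a matrix of rank at most 1, so the minor of size \<open>k + 1\<close>, a
  polynomial of degree \<open>k + 1\<close> in the entries, vanishes on sums of \<open>k\<close> pure tensors.
\<close>

lemma flattening_minors_vanish:
  assumes "T \<in> rank_approximation k (Suc k) ns"
  shows "fdet (Suc k) (\<lambda>s t. tensor_form ns T (merge J (xs s) (ys t))) = 0"
proof -
  let ?g = "\<lambda>T. fdet (Suc k) (\<lambda>s t. tensor_form ns T (merge J (xs s) (ys t)))"
  have form: "(\<lambda>T. tensor_form ns T y) \<in> poly_maps (tensor_positions ns) 1" for y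
    unfolding tensor_form_def
    by (subst mult.commute) (intro poly_maps_sum poly_maps_scale poly_maps_var)
  have "?g \<in> poly_maps (tensor_positions ns) (\<Sum>i<Suc k. 1)"
    unfolding fdet_leibniz by (intro poly_maps_sum poly_maps_scale poly_maps_prod form)
  moreover have "vanishing k ns ?g"
    unfolding vanishing_def
  proof (intro ballI impI)
    fix T :: "nat list \<Rightarrow> 'a" assume "tensor_rank ns T \<le> enat k"
    then obtain r \<tau> where r: "r \<le> k" "\<forall>t<r. pure_tensor ns (\<tau> t)"
      and T: "\<And>w. w \<in> tensor_positions ns \<Longrightarrow> T w = (\<Sum>t<r. \<tau> t w)"
      unfolding tensor_rank_le_iff sum_of_pure_tensors_def by blast
    from r(2) have "\<forall>t. \<exists>z. t < r \<longrightarrow> (\<forall>w\<in>tensor_positions ns. \<tau> t w = (\<Prod>j<length ns. z j (w ! j)))"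
      unfolding pure_tensor_def by blast
    then obtain z where z: "\<And>t w. t < r \<Longrightarrow> w \<in> tensor_positions ns \<Longrightarrow> \<tau> t w = (\<Prod>j<length ns. z t j (w ! j))"
      by metis
    let ?f = "\<lambda>t y j. \<Sum>v<ns ! j. z t j v * y j v"
    let ?u = "\<lambda>t s. \<Prod>j\<in>{j\<in>{..<length ns}. j \<in> J}. ?f t (xs s) j"
    let ?v = "\<lambda>t s. \<Prod>j\<in>{j\<in>{..<length ns}. j \<notin> J}. ?f t (ys s) j"
    have "tensor_form ns (\<tau> t) (merge J (xs i) (ys j)) = ?u t i * ?v t j" if "t < r" for t i j
    proof -
      have "tensor_form ns (\<tau> t) (merge J (xs i) (ys j)) = (\<Prod>a<length ns. ?f t (merge J (xs i) (ys j)) a)"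
        using z[OF that] by (intro tensor_form_product)
      also have "\<dots> = (\<Prod>a<length ns. if a \<in> J then ?f t (xs i) a else ?f t (ys j) a)"
        by (intro prod.cong) (auto simp: merge_def)
      also have "\<dots> = ?u t i * ?v t j"
        by (subst prod.If_cases) (auto simp: Int_def intro!: arg_cong2[of _ _ _ _ "(*)"] prod.cong)
      finally show ?thesis .
    qed
    then have "?g T = fdet (Suc k) (\<lambda>i j. \<Sum>t<r. ?u t i * ?v t j)"
      using T by (intro fdet_cong) (simp add: tensor_form_sum[of ns T \<tau> "{..<r}"])
    then show "?g T = 0"
      using r(1) by (simp add: fdet_rank_deficient)
  qed
  ultimately show ?thesis
    using assms unfolding rank_approximation_def by auto
qed

section \<open>Reduction to factors of bounded dimension\<close>

text \<open>
  The rows \<open>xs\<close> of a nonzero minor of maximal size span all rows. The coefficients depend on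
  \<open>x\<close> only through the row \<open>M x\<close>; so, for a flattening along a single position \<open>a\<close>, they
  depend on the vector at \<open>a\<close> only.
\<close>

lemma low_rank_factorization:
  fixes M :: "'x \<Rightarrow> 'y \<Rightarrow> 'k::field"
  assumes "\<And>xs ys. fdet (Suc k) (\<lambda>s t. M (xs s) (ys t)) = 0"
  shows "\<exists>\<alpha> xs. \<forall>x y. M x y = (\<Sum>u<k. \<alpha> u (M x) * M (xs u) y)"
proof -
  define good where "good r \<longleftrightarrow> r \<le> k \<and> (\<exists>xs ys. fdet r (\<lambda>s t. M (xs s) (ys t)) \<noteq> 0)" for r
  have "good 0"
    unfolding good_def by (auto simp: fdet_eq_0_iff)
  define r where "r = (GREATEST r. good r)"
  have good: "good r" and greatest: "\<And>r'. good r' \<Longrightarrow> r' \<le> r"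
    unfolding r_def
    using GreatestI_nat[of good 0 k] Greatest_le_nat[of good _ k] \<open>good 0\<close> by (auto simp: good_def)
  from good obtain xs ys where "r \<le> k" and nz: "fdet r (\<lambda>s t. M (xs s) (ys t)) \<noteq> 0"
    unfolding good_def by blast
  have maximal: "fdet (Suc r) (\<lambda>s t. M (xs' s) (ys' t)) = 0" for xs' ys'
  proof (rule ccontr)
    assume nz': "\<not> ?thesis"
    then have "r \<noteq> k" using assms by metis
    then have "good (Suc r)"
      using nz' \<open>r \<le> k\<close> unfolding good_def by auto
    then show False using greatest[of "Suc r"] by simp
  qed
  from nz obtain G where
    G: "\<And>i j. i < r \<Longrightarrow> j < r \<Longrightarrow> (\<Sum>u<r. M (xs i) (ys u) * G u j) = (if i = j then 1 else 0)"
    by (rule fdet_nonzero_inverse) blast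
  define \<alpha> where "\<alpha> u f = (if u < r then \<Sum>w<r. f (ys w) * G w u else 0)" for u and f :: "'y \<Rightarrow> 'k"
  have "M x y = (\<Sum>u<k. \<alpha> u (M x) * M (xs u) y)" for x y
  proof -
    have "M x y = (\<Sum>u<r. \<alpha> u (M x) * M (xs u) y)"
      using bordered_minor[of r M xs ys x y, OF nz maximal G] by (simp add: \<alpha>_def)
    also have "\<dots> = (\<Sum>u<k. \<alpha> u (M x) * M (xs u) y)"
      using \<open>r \<le> k\<close> by (intro sum.mono_neutral_left) (auto simp: \<alpha>_def)
    finally show ?thesis .
  qed
  then show ?thesis by blast
qed

fun list_index :: "'a list \<Rightarrow> 'a \<Rightarrow> nat" where
  "list_index [] a = 0"
| "list_index (x # xs) a = (if x = a then 0 else Suc (list_index xs a))"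

lemma list_index_less: "a \<in> set xs \<Longrightarrow> list_index xs a < length xs"
  by (induction xs) auto

lemma list_index_nth: "distinct xs \<Longrightarrow> b < length xs \<Longrightarrow> list_index xs (xs ! b) = b"
proof (induction xs arbitrary: b)
  case (Cons x xs)
  then show ?case by (cases b) auto
qed simp

text \<open>
  For a single position \<open>a\<close> this is the factorisation of the flattening along \<open>{a}\<close>: at \<open>a\<close>, it is enough
  to know \<open>F\<close> at the \<open>k\<close> vectors \<open>\<beta> a v\<close>. Iterating over the list \<open>ps\<close> of positions gives the
  claim. In terms of tensors, contraction with the vectors \<open>\<beta>\<close> maps to a format with all sizes
  equal to \<open>k\<close>, and the coefficients \<open>\<alpha>\<close> define a map back that recovers the tensor.
\<close>

lemma small_format_expansion:
  fixes F :: "(nat \<Rightarrow> nat \<Rightarrow> 'k::field) \<Rightarrow> 'k"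
  assumes rank: "\<And>J xs ys. J \<subseteq> {..<p} \<Longrightarrow> fdet (Suc k) (\<lambda>s t. F (merge J (xs s) (ys t))) = 0"
  shows "\<exists>\<alpha> \<beta>. \<forall>ps y. distinct ps \<longrightarrow> set ps \<subseteq> {..<p} \<longrightarrow>
    F y = (\<Sum>u\<in>tensor_positions (replicate (length ps) k).
      (\<Prod>b<length ps. \<alpha> (ps ! b) (y (ps ! b)) (u ! b)) *
      F (\<lambda>a. if a \<in> set ps then \<beta> a (u ! list_index ps a) else y a))"
proof -
  have "\<exists>\<alpha> \<beta>. \<forall>y. F y = (\<Sum>v<k. \<alpha> (y a) v * F (y(a := \<beta> v)))" if "a < p" for a
  proof -
    have mg: "merge {a} x z = z(a := x a)" for x z :: "nat \<Rightarrow> nat \<Rightarrow> 'k"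
      by (auto simp: merge_def)
    have "fdet (Suc k) (\<lambda>s t. F (merge {a} (xs s) (ys t))) = 0" for xs ys
      using that by (intro rank) auto
    from low_rank_factorization[of k "\<lambda>x y. F (merge {a} x y)", OF this] obtain \<alpha> xs where
      eq: "\<And>x y. F (merge {a} x y) = (\<Sum>u<k. \<alpha> u (\<lambda>y. F (merge {a} x y)) * F (merge {a} (xs u) y))"
      by blast
    have "F y = (\<Sum>v<k. \<alpha> v (\<lambda>z. F (z(a := y a))) * F (y(a := xs v a)))" for y
      using eq[of y y] by (simp add: mg)
    then show ?thesis
      by (intro exI[of _ "\<lambda>c v. \<alpha> v (\<lambda>z. F (z(a := c)))"] exI[of _ "\<lambda>v. xs v a"] allI)
  qed
  then have "\<forall>a. \<exists>\<alpha> \<beta>. a < p \<longrightarrow> (\<forall>y. F y = (\<Sum>v<k. \<alpha> (y a) v * F (y(a := \<beta> v))))"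
    by blast
  then obtain \<alpha> where "\<forall>a. \<exists>\<beta>. a < p \<longrightarrow> (\<forall>y. F y = (\<Sum>v<k. \<alpha> a (y a) v * F (y(a := \<beta> v))))"
    by (rule choice[THEN exE])
  then obtain \<beta> where \<alpha>\<beta>: "\<forall>a. a < p \<longrightarrow> (\<forall>y. F y = (\<Sum>v<k. \<alpha> a (y a) v * F (y(a := \<beta> a v))))"
    by (rule choice[THEN exE])
  have "F y = (\<Sum>u\<in>tensor_positions (replicate (length ps) k).
      (\<Prod>b<length ps. \<alpha> (ps ! b) (y (ps ! b)) (u ! b)) *
      F (\<lambda>a. if a \<in> set ps then \<beta> a (u ! list_index ps a) else y a))"
    if "distinct ps" "set ps \<subseteq> {..<p}" for ps y
    using that
  proof (induction ps arbitrary: y)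
    case Nil
    then show ?case by (simp add: tensor_positions_Nil)
  next
    case (Cons a ps)
    have a: "a < p" "a \<notin> set ps" "distinct ps" "set ps \<subseteq> {..<p}" using Cons.prems by auto
    have step: "F (y(a := \<beta> a v)) = (\<Sum>u\<in>tensor_positions (replicate (length ps) k).
      (\<Prod>b<length ps. \<alpha> (ps ! b) (y (ps ! b)) (u ! b)) *
      F (\<lambda>c. if c \<in> set (a # ps) then \<beta> c ((v # u) ! list_index (a # ps) c) else y c))" for v
    proof -
      have 1: "ps ! b \<noteq> a" if "b < length ps" for b
        using a(2) that nth_mem by blast
      have 2: "(\<lambda>c. if c \<in> set ps then \<beta> c (u ! list_index ps c) else (y(a := \<beta> a v)) c) =
          (\<lambda>c. if c \<in> set (a # ps) then \<beta> c ((v # u) ! list_index (a # ps) c) else y c)" for u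
        using a(2) by (auto simp: fun_eq_iff)
      show ?thesis
        unfolding Cons.IH[OF a(3,4), of "y(a := \<beta> a v)"] 2
        by (intro sum.cong arg_cong2[of _ _ _ _ "(*)"] prod.cong refl) (simp add: 1)
    qed
    have "F y = (\<Sum>v<k. \<alpha> a (y a) v * F (y(a := \<beta> a v)))"
      using \<alpha>\<beta> a(1) by blast
    also have "\<dots> = (\<Sum>v<k. \<Sum>u\<in>tensor_positions (replicate (length ps) k).
        (\<Prod>b<length (a # ps). \<alpha> ((a # ps) ! b) (y ((a # ps) ! b)) ((v # u) ! b)) *
        F (\<lambda>c. if c \<in> set (a # ps) then \<beta> c ((v # u) ! list_index (a # ps) c) else y c))"
      unfolding step sum_distrib_left length_Cons prod.lessThan_Suc_shift
      by (intro sum.cong refl) (simp only: nth_Cons_0 nth_Cons_Suc mult.assoc)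
    finally show ?case
      unfolding length_Cons replicate_Suc sum_tensor_positions_Cons .
  qed
  then show ?thesis by blast
qed

section \<open>Parametrisation by words of letters\<close>

lemma word_monom_mult:
  assumes "shape M q u" "shape M q v"
  shows "word_monom u a * word_monom v a = word_monom (map2 (map2 (+)) u v) a"
proof -
  have "length u = length v" using assms by (simp add: shape_def)
  then show ?thesis using assms
  proof (induction u v arbitrary: a q rule: list_induct2)
    case Nil
    then show ?case by (cases a) auto
  next
    case (Cons d u e v)
    then obtain q' where q: "shape M q' u" "shape M q' v" "length d = length e" by auto
    show ?case
    proof (cases a)
      case (Cons x xs)
      then show ?thesis
        using Cons.IH[OF q(1,2), of xs] q(3) by (simp add: letter_monom_add mult_ac)
    qed simp
  qed
qed

lemma shape_add: "shape M q u \<Longrightarrow> shape M q v \<Longrightarrow> shape M q (map2 (map2 (+)) u v)"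
  by (auto simp: shape_def set_zip)

lemma word_monom_nth:
  "length u = length a \<Longrightarrow> word_monom u a = (\<Prod>b<length a. letter_monom (u ! b) (a ! b))"
  by (induction u a rule: list_induct2) (simp_all add: prod.lessThan_Suc_shift del: prod.lessThan_Suc)

text \<open>
  Polynomials in \<open>q\<close> letters, as functions on words of length \<open>q\<close>; on other words the function is
  irrelevant. Allowing this freedom makes the constants and the coordinates belong to the algebra.
\<close>

definition word_polys :: "nat \<Rightarrow> nat \<Rightarrow> ((nat \<Rightarrow> 'k::field) list \<Rightarrow> 'k) set" where
  "word_polys M q = {g. \<exists>g'\<in>fspan (word_monom ` {u. shape M q u}). \<forall>a. length a = q \<longrightarrow> g a = g' a}"

lemma word_polysI:
  assumes "shape M q u" "\<And>a. length a = q \<Longrightarrow> g a = word_monom u a"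
  shows "g \<in> word_polys M q"
  unfolding word_polys_def using assms by (auto intro!: bexI[of _ "word_monom u"] fspan_base)

lemma word_polys_add: "f \<in> word_polys M q \<Longrightarrow> g \<in> word_polys M q \<Longrightarrow> (\<lambda>a. f a + g a) \<in> word_polys M q"
  unfolding word_polys_def by (auto intro: bexI[OF _ fspan_add])

lemma word_polys_mult:
  assumes "f \<in> word_polys M q" "g \<in> word_polys M q"
  shows "(\<lambda>a. f a * g a) \<in> word_polys M q"
proof -
  obtain f' g' where
    f': "f' \<in> fspan (word_monom ` {u. shape M q u})" "\<And>a. length a = q \<Longrightarrow> f a = f' a" and
    g': "g' \<in> fspan (word_monom ` {u. shape M q u})" "\<And>a. length a = q \<Longrightarrow> g a = g' a"
    using assms unfolding word_polys_def by blast
  have "(\<lambda>a. f' a * g' a) \<in> fspan (word_monom ` {u. shape M q u})"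
    using f'(1) g'(1)
  proof (rule fspan_mult)
    fix b c :: "(nat \<Rightarrow> 'a) list \<Rightarrow> 'a"
    assume "b \<in> word_monom ` {u. shape M q u}" "c \<in> word_monom ` {u. shape M q u}"
    then obtain u v where uv: "b = word_monom u" "shape M q u" "c = word_monom v" "shape M q v"
      by auto
    then have "(\<lambda>a. b a * c a) = word_monom (map2 (map2 (+)) u v)"
      by (simp add: fun_eq_iff word_monom_mult)
    then show "(\<lambda>a. b a * c a) \<in> fspan (word_monom ` {u. shape M q u})"
      using uv by (simp add: fspan_base shape_add)
  qed
  then show ?thesis
    unfolding word_polys_def using f'(2) g'(2) by auto
qed

lemma word_polys_const: "(\<lambda>_. c) \<in> word_polys M q"
proof -
  let ?u = "replicate q (replicate M 0)"
  have "word_monom ?u a = 1" if "length a = q" for a :: "(nat \<Rightarrow> 'a) list"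
    using that by (simp add: word_monom_nth letter_monom_def)
  moreover have "(\<lambda>a. c * word_monom ?u a) \<in> fspan (word_monom ` {u. shape M q u})"
    by (intro fspan_scale fspan_base) (auto simp: shape_def)
  ultimately show ?thesis
    unfolding word_polys_def by (auto intro!: bexI[of _ "\<lambda>a. c * word_monom ?u a"])
qed

lemma word_polys_sum:
  "(\<And>i. i \<in> I \<Longrightarrow> f i \<in> word_polys M q) \<Longrightarrow> (\<lambda>a. \<Sum>i\<in>I. f i a) \<in> word_polys M q"
  by (induction I rule: infinite_finite_induct) (auto intro: word_polys_const word_polys_add)

lemma word_polys_coordinate:
  assumes "b < q" "m < M"
  shows "(\<lambda>a. (a ! b) m) \<in> word_polys M q"
proof (rule word_polysI)
  define e where "e = (replicate M 0)[m := 1 :: nat]"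
  let ?u = "(replicate q (replicate M 0))[b := e]"
  have len_e: "length e = M" by (simp add: e_def)
  show "shape M q ?u"
    unfolding shape_def using len_e set_update_subset_insert[of "replicate q (replicate M 0)" b e]
    by fastforce
  fix a :: "(nat \<Rightarrow> 'a) list" assume len: "length a = q"
  have e: "letter_monom e x = x m" for x :: "nat \<Rightarrow> 'a"
  proof -
    have "letter_monom e x = (\<Prod>j<M. if j = m then x m else 1)"
      unfolding letter_monom_def len_e by (intro prod.cong) (auto simp: e_def nth_list_update)
    then show ?thesis using assms(2) by simp
  qed
  have one: "letter_monom (replicate M 0) x = 1" for x :: "nat \<Rightarrow> 'a"
    by (simp add: letter_monom_def)
  have len': "length ?u = length a" using len by simp
  have "word_monom ?u a = (\<Prod>j<q. if j = b then (a ! b) m else 1)"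
    unfolding word_monom_nth[OF len'] len using assms(1)
    by (intro prod.cong) (auto simp: e one nth_list_update)
  then show "(a ! b) m = word_monom ?u a"
    using assms(1) by simp
qed

lemma mat_chain_map:
  "mat_chain r X (map f bs) y s t = mat_chain r (\<lambda>b. X (f b)) bs (\<lambda>b. y (f b)) s t"
  by (induction bs arbitrary: s) simp_all

lemma mat_chain_cong:
  "(\<And>a s u. a \<in> set as \<Longrightarrow> X a (y a) s u = X' a (y' a) s u) \<Longrightarrow>
    mat_chain r X as y s t = mat_chain r X' as y' s t"
  by (induction as arbitrary: s) (auto intro!: sum.cong)

lemma word_polys_mat_chain:
  assumes "\<And>a s u. a \<in> set as \<Longrightarrow> s < r \<Longrightarrow> u < r \<Longrightarrow> (\<lambda>c. X c a (y a) s u) \<in> word_polys M q"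
    and "s < r"
  shows "(\<lambda>c. mat_chain r (X c) as y s t) \<in> word_polys M q"
  using assms
proof (induction as arbitrary: s)
  case Nil
  then show ?case by (simp add: word_polys_const)
next
  case (Cons a as)
  then show ?case
    unfolding mat_chain.simps by (intro word_polys_sum word_polys_mult) auto
qed

text \<open>
  The matrix product as a function of the letters of a word \<open>c\<close>. The first letter supplies the head
  data, stored under tag 0, at the first \<open>h\<close> indices of \<open>u\<close>; the letter number \<open>b + 1\<close> supplies the matrix,
  stored under tag 1, for the index \<open>u ! (h + b)\<close>. Coordinates of letters are numbered by \<open>to_nat\<close>.
\<close>

definition chain_tensor :: "nat \<Rightarrow> nat \<Rightarrow> nat \<Rightarrow> (nat \<Rightarrow> 'k::field) list \<Rightarrow> nat list \<Rightarrow> 'k" where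
  "chain_tensor r h q c u = (\<Sum>s<r. \<Sum>t<r. (c ! 0) (to_nat (0::nat, s, t, take h u)) *
     mat_chain r (\<lambda>b v s t. (c ! Suc b) (to_nat (1::nat, s, t, [v]))) [0..<q] (\<lambda>b. u ! (h + b)) s t)"

lemma word_polys_chain_tensor:
  assumes M: "\<And>tag s t us. tag \<le> (1::nat) \<Longrightarrow> s < r \<Longrightarrow> t < r \<Longrightarrow> set us \<subseteq> {..<k} \<Longrightarrow>
      length us \<le> Suc h \<Longrightarrow> to_nat (tag, s, t, us) < M"
    and u: "u \<in> tensor_positions (replicate (h + q) k)"
  shows "(\<lambda>c. chain_tensor r h q c u) \<in> word_polys M (Suc q)"
proof -
  have uk: "u ! b < k" if "b < h + q" for b
    using u that by (simp add: tensor_positions_replicate)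
  have "set (take h u) \<subseteq> {..<k}"
    using u by (auto simp: tensor_positions_replicate in_set_conv_nth)
  then show ?thesis
    unfolding chain_tensor_def
    by (intro word_polys_sum word_polys_mult word_polys_mat_chain word_polys_coordinate M)
      (auto simp: uk)
qed

text \<open>
  The data attached to one multilinear form \<open>F\<close>: the matrix product with head positions \<open>hs\<close>, matrix
  positions \<open>qs\<close> and contraction vectors \<open>l\<close>, and the reduction \<open>\<alpha>, \<beta>\<close> to factors of dimension \<open>k\<close>.
\<close>

definition normal_form ::
    "nat \<Rightarrow> nat \<Rightarrow> ((nat \<Rightarrow> nat \<Rightarrow> 'k::field) \<Rightarrow> 'k) \<Rightarrow> nat \<Rightarrow> nat list \<Rightarrow> nat list \<Rightarrow>
     (nat \<Rightarrow> nat \<Rightarrow> 'k) \<Rightarrow> (nat \<Rightarrow> nat \<Rightarrow> (nat \<Rightarrow> 'k) list \<Rightarrow> 'k) \<Rightarrow>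
     (nat \<Rightarrow> (nat \<Rightarrow> 'k) \<Rightarrow> nat \<Rightarrow> nat \<Rightarrow> 'k) \<Rightarrow> (nat \<Rightarrow> (nat \<Rightarrow> 'k) \<Rightarrow> nat \<Rightarrow> 'k) \<Rightarrow>
     (nat \<Rightarrow> nat \<Rightarrow> nat \<Rightarrow> 'k) \<Rightarrow> bool" where
  "normal_form k p F r hs qs l B X \<alpha> \<beta> \<longleftrightarrow>
    r \<le> k \<and> distinct (hs @ qs) \<and> set (hs @ qs) = {..<p} \<and> length hs \<le> 2 * k \<and>
    (\<forall>a\<in>set qs. \<forall>s<r. \<forall>u<r. X a (l a) s u = (if s = u then 1 else 0)) \<and>
    (\<forall>y. F y = (\<Sum>s<r. \<Sum>t<r. B s t (map y hs) * mat_chain r X qs y s t)) \<and>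
    (\<forall>ps y. distinct ps \<longrightarrow> set ps \<subseteq> {..<p} \<longrightarrow>
       F y = (\<Sum>u\<in>tensor_positions (replicate (length ps) k).
         (\<Prod>b<length ps. \<alpha> (ps ! b) (y (ps ! b)) (u ! b)) *
         F (\<lambda>a. if a \<in> set ps then \<beta> a (u ! list_index ps a) else y a)))"

lemma normal_form_exists:
  fixes T :: "nat list \<Rightarrow> 'k::field"
  assumes inf: "infinite (UNIV :: 'k set)" and T: "T \<in> rank_approximation k (Suc k) ns"
  shows "\<exists>r hs qs l B X \<alpha> \<beta>. normal_form k (length ns) (tensor_form ns T) r hs qs l B X \<alpha> \<beta>"
proof -
  have minors: "fdet (Suc k) (\<lambda>s t. tensor_form ns T (merge J (xs s) (ys t))) = 0" for J xs ys
    by (rule flattening_minors_vanish[OF T])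
  obtain \<alpha> \<beta> where \<alpha>\<beta>: "\<forall>ps y. distinct ps \<longrightarrow> set ps \<subseteq> {..<length ns} \<longrightarrow>
    tensor_form ns T y = (\<Sum>u\<in>tensor_positions (replicate (length ps) k).
      (\<Prod>b<length ps. \<alpha> (ps ! b) (y (ps ! b)) (u ! b)) *
      tensor_form ns T (\<lambda>a. if a \<in> set ps then \<beta> a (u ! list_index ps a) else y a))"
    using small_format_expansion[of "length ns" k "tensor_form ns T", OF minors] by (elim exE)
  have "\<exists>r hs qs l B X. r \<le> k \<and> distinct (hs @ qs) \<and> set (hs @ qs) = {..<length ns} \<and>
    length hs \<le> 2 * k \<and>
    (\<forall>a\<in>set qs. \<forall>s<r. \<forall>u<r. X a (l a) s u = (if s = u then 1 else 0)) \<and>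
    (\<forall>y. tensor_form ns T y = (\<Sum>s<r. \<Sum>t<r. B s t (map y hs) * mat_chain r X qs y s t))"
    by (rule matrix_product_form[OF inf])
      (auto intro: tensor_form_cong tensor_form_polynomial_along_line simp: minors)
  then obtain r hs qs l B X where "r \<le> k \<and> distinct (hs @ qs) \<and> set (hs @ qs) = {..<length ns} \<and>
    length hs \<le> 2 * k \<and>
    (\<forall>a\<in>set qs. \<forall>s<r. \<forall>u<r. X a (l a) s u = (if s = u then 1 else 0)) \<and>
    (\<forall>y. tensor_form ns T y = (\<Sum>s<r. \<Sum>t<r. B s t (map y hs) * mat_chain r X qs y s t))"
    by (elim exE)
  with \<alpha>\<beta> have "normal_form k (length ns) (tensor_form ns T) r hs qs l B X \<alpha> \<beta>"
    unfolding normal_form_def by (elim conjE, intro conjI)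
  then show ?thesis by (intro exI)
qed

text \<open>
  Every letter contains the head data, because a subword has to contain them as well, whichever of the
  letters it keeps. The tags 0 and 1 are those of \<open>chain_tensor\<close>.
\<close>

definition chain_letter ::
    "nat list \<Rightarrow> (nat \<Rightarrow> nat \<Rightarrow> (nat \<Rightarrow> 'k::field) list \<Rightarrow> 'k) \<Rightarrow>
     (nat \<Rightarrow> (nat \<Rightarrow> 'k) \<Rightarrow> nat \<Rightarrow> nat \<Rightarrow> 'k) \<Rightarrow> (nat \<Rightarrow> nat \<Rightarrow> nat \<Rightarrow> 'k) \<Rightarrow>
     nat \<Rightarrow> nat \<Rightarrow> 'k" where
  "chain_letter hs B X \<beta> a m = (case from_nat m of (tag :: nat, s :: nat, t :: nat, us :: nat list) \<Rightarrow>
     if tag = 0 then B s t (map2 \<beta> hs us) else X a (\<beta> a (hd us)) s t)"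

text \<open>
  Contracting the matrix positions outside the subsequence \<open>qs'\<close> with \<open>l\<close>, and the others with the
  vectors \<open>\<beta>\<close>, has the effect of passing to a subword: at \<open>l\<close> the matrices are identities.
\<close>

lemma normal_form_contraction:
  assumes nf: "normal_form k p F r hs qs l B X \<alpha> \<beta>" and sub: "subseq qs' qs"
    and c: "c ! 0 = chain_letter hs B X \<beta> a0" "tl c = map (chain_letter hs B X \<beta>) qs'" "c \<noteq> []"
    and u: "length u = length (hs @ qs')"
  shows "F (\<lambda>a. if a \<in> set (hs @ qs') then \<beta> a (u ! list_index (hs @ qs') a) else l a) =
    chain_tensor r (length hs) (length qs') c u"
proof -
  let ?ps = "hs @ qs'"
  let ?y = "\<lambda>a. if a \<in> set ?ps then \<beta> a (u ! list_index ?ps a) else l a"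
  have dist: "distinct hs" "distinct qs" "set hs \<inter> set qs = {}"
    and id: "\<forall>a\<in>set qs. \<forall>s<r. \<forall>u<r. X a (l a) s u = (if s = u then 1 else 0)"
    and F: "\<forall>y. F y = (\<Sum>s<r. \<Sum>t<r. B s t (map y hs) * mat_chain r X qs y s t)"
    using nf unfolding normal_form_def by auto
  have filt: "qs' = filter (\<lambda>a. a \<in> set qs') qs"
    using subseq_distinct_filter[OF sub dist(2)] .
  have dps: "distinct ?ps"
    using dist subseq_set_subset[OF sub] filt by (metis distinct_append distinct_filter inf_mono inf.absorb_iff2 order_refl subset_empty)
  have y: "?y (?ps ! b) = \<beta> (?ps ! b) (u ! b)" if "b < length ?ps" for b
    using that list_index_nth[OF dps that] nth_mem[OF that] by simp
  have head: "map ?y hs = map2 \<beta> hs (take (length hs) u)"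
  proof (rule nth_equalityI)
    fix b assume "b < length (map ?y hs)"
    then have b: "b < length hs" by simp
    then have "?y (hs ! b) = \<beta> (hs ! b) (u ! b)"
      using y[of b] by (simp add: nth_append)
    then show "map ?y hs ! b = map2 \<beta> hs (take (length hs) u) ! b"
      using b u by simp
  qed (use u in simp)
  have "mat_chain r X qs ?y s t =
      mat_chain r (\<lambda>b v s t. (c ! Suc b) (to_nat (1::nat, s, t, [v]))) [0..<length qs']
        (\<lambda>b. u ! (length hs + b)) s t" if "s < r" for s t
  proof -
    have "\<forall>a\<in>set qs. \<not> (\<lambda>a. a \<in> set qs') a \<longrightarrow> (\<forall>s<r. \<forall>u<r. X a (?y a) s u = (if s = u then 1 else 0))"
    proof (intro ballI impI)
      fix a assume a: "a \<in> set qs" "\<not> (\<lambda>a. a \<in> set qs') a"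
      then have "?y a = l a" using dist(3) by auto
      then show "\<forall>s<r. \<forall>u<r. X a (?y a) s u = (if s = u then 1 else 0)"
        using id a(1) by metis
    qed
    from mat_chain_filter[of qs "\<lambda>a. a \<in> set qs'" r X ?y s t, OF this that] have "mat_chain r X qs ?y s t = mat_chain r X qs' ?y s t"
      using filt by metis
    also have "\<dots> = mat_chain r X (map (nth qs') [0..<length qs']) ?y s t"
      by (simp only: map_nth)
    also have "\<dots> = mat_chain r (\<lambda>b. X (qs' ! b)) [0..<length qs'] (\<lambda>b. ?y (qs' ! b)) s t"
      by (rule mat_chain_map)
    also have "\<dots> = mat_chain r (\<lambda>b v s t. (c ! Suc b) (to_nat (1::nat, s, t, [v]))) [0..<length qs']
        (\<lambda>b. u ! (length hs + b)) s t"
    proof (rule mat_chain_cong)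
      fix b s t assume "b \<in> set [0..<length qs']"
      then have b: "b < length qs'" by simp
      then have "?y (qs' ! b) = \<beta> (qs' ! b) (u ! (length hs + b))"
        using y[of "length hs + b"] by (simp add: nth_append)
      moreover have "c ! Suc b = chain_letter hs B X \<beta> (qs' ! b)"
        using c b by (metis nth_map nth_tl length_map)
      ultimately show "X (qs' ! b) (?y (qs' ! b)) s t =
          (c ! Suc b) (to_nat (1::nat, s, t, [u ! (length hs + b)]))"
        by (simp add: chain_letter_def)
    qed
    finally show ?thesis .
  qed
  then have "F ?y = (\<Sum>s<r. \<Sum>t<r. B s t (map2 \<beta> hs (take (length hs) u)) *
      mat_chain r (\<lambda>b v s t. (c ! Suc b) (to_nat (1::nat, s, t, [v]))) [0..<length qs']
        (\<lambda>b. u ! (length hs + b)) s t)"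
    unfolding F[rule_format, of ?y] head by (intro sum.cong refl) simp
  then show ?thesis
    unfolding chain_tensor_def c(1) by (simp add: chain_letter_def)
qed

section \<open>Boundedness of the degree\<close>

text \<open>
  After passing to a subsequence on which the size \<open>r\<close> of the matrices and the length \<open>h\<close> of the head
  are constant, the letters of all words have coordinates in the same finite set. The map \<open>C\<close> contracts
  and passes to factors of dimension \<open>k\<close>, and \<open>E n\<close> leads from there to the format of the \<open>n\<close>-th
  tensor. Both are natural, and applied to the whole word of the \<open>n\<close>-th tensor they recover this
  tensor.
\<close>

lemma no_bad_sequence:
  fixes T :: "nat \<Rightarrow> nat list \<Rightarrow> 'k::field"
  assumes inf: "infinite (UNIV :: 'k set)"
    and T: "\<And>i. T i \<in> rank_approximation k (Suc k) (ns i)"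
    and T_later: "\<And>i j. i < j \<Longrightarrow> T j \<in> rank_approximation k (e i) (ns j)"
    and g: "\<And>i. g i \<in> poly_maps (tensor_positions (ns i)) (e i)" "\<And>i. vanishing k (ns i) (g i)"
    and nz: "\<And>i. g i (T i) \<noteq> 0"
  shows False
proof -
  have "\<forall>i. \<exists>r hs qs l B X \<alpha> \<beta>. normal_form k (length (ns i)) (tensor_form (ns i) (T i)) r hs qs l B X \<alpha> \<beta>"
    using normal_form_exists[OF inf T] by blast
  then obtain r where "\<forall>i. \<exists>hs qs l B X \<alpha> \<beta>.
      normal_form k (length (ns i)) (tensor_form (ns i) (T i)) (r i) hs qs l B X \<alpha> \<beta>"
    by (rule choice[THEN exE])
  then obtain hs where "\<forall>i. \<exists>qs l B X \<alpha> \<beta>.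
      normal_form k (length (ns i)) (tensor_form (ns i) (T i)) (r i) (hs i) qs l B X \<alpha> \<beta>"
    by (rule choice[THEN exE])
  then obtain qs where "\<forall>i. \<exists>l B X \<alpha> \<beta>.
      normal_form k (length (ns i)) (tensor_form (ns i) (T i)) (r i) (hs i) (qs i) l B X \<alpha> \<beta>"
    by (rule choice[THEN exE])
  then obtain l where "\<forall>i. \<exists>B X \<alpha> \<beta>.
      normal_form k (length (ns i)) (tensor_form (ns i) (T i)) (r i) (hs i) (qs i) (l i) B X \<alpha> \<beta>"
    by (rule choice[THEN exE])
  then obtain B where "\<forall>i. \<exists>X \<alpha> \<beta>.
      normal_form k (length (ns i)) (tensor_form (ns i) (T i)) (r i) (hs i) (qs i) (l i) (B i) X \<alpha> \<beta>"
    by (rule choice[THEN exE])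
  then obtain X where "\<forall>i. \<exists>\<alpha> \<beta>.
      normal_form k (length (ns i)) (tensor_form (ns i) (T i)) (r i) (hs i) (qs i) (l i) (B i) (X i) \<alpha> \<beta>"
    by (rule choice[THEN exE])
  then obtain \<alpha> where "\<forall>i. \<exists>\<beta>.
      normal_form k (length (ns i)) (tensor_form (ns i) (T i)) (r i) (hs i) (qs i) (l i) (B i) (X i) (\<alpha> i) \<beta>"
    by (rule choice[THEN exE])
  then obtain \<beta> where "\<forall>i.
      normal_form k (length (ns i)) (tensor_form (ns i) (T i)) (r i) (hs i) (qs i) (l i) (B i) (X i) (\<alpha> i) (\<beta> i)"
    by (rule choice[THEN exE])
  then have nf: "normal_form k (length (ns i)) (tensor_form (ns i) (T i))
      (r i) (hs i) (qs i) (l i) (B i) (X i) (\<alpha> i) (\<beta> i)" for i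
    by blast
  have r: "r i \<le> k" and dist: "distinct (hs i @ qs i)" and set_ps: "set (hs i @ qs i) = {..<length (ns i)}"
    and h_le: "length (hs i) \<le> 2 * k" for i
    by (rule nf[unfolded normal_form_def, THEN conjunct1]
        nf[unfolded normal_form_def, THEN conjunct2, THEN conjunct1]
        nf[unfolded normal_form_def, THEN conjunct2, THEN conjunct2, THEN conjunct1]
        nf[unfolded normal_form_def, THEN conjunct2, THEN conjunct2, THEN conjunct2, THEN conjunct1])+
  have expansion: "tensor_form (ns i) (T i) y =
      (\<Sum>u\<in>tensor_positions (replicate (length (hs i @ qs i)) k).
         (\<Prod>b<length (hs i @ qs i). \<alpha> i ((hs i @ qs i) ! b) (y ((hs i @ qs i) ! b)) (u ! b)) *
         tensor_form (ns i) (T i) (\<lambda>a. if a \<in> set (hs i @ qs i) then \<beta> i a (u ! list_index (hs i @ qs i) a) else y a))"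
    for i y
    using nf[of i] dist[of i] set_ps[of i] unfolding normal_form_def by blast
  have len_ps: "length (hs i @ qs i) = length (ns i)" for i
    using distinct_card[OF dist[of i]] set_ps[of i] by simp
  \<comment> \<open>Whether the format is empty is recorded too: contracting all factors of a tensor is not a natural map
    to the empty format, since the only pure tensor there is the scalar 1.\<close>
  define kind where "kind i = (r i, length (hs i), ns i = [])" for i
  have "kind ` UNIV \<subseteq> {..k} \<times> {..2 * k} \<times> UNIV"
    using r h_le by (auto simp: kind_def)
  then have "finite (kind ` UNIV)"
    by (rule finite_subset) simp
  then obtain i0 where "infinite {i \<in> UNIV. kind i = kind i0}"
    using pigeonhole_infinite[of UNIV kind] by auto
  then obtain \<phi> :: "nat \<Rightarrow> nat" where \<phi>: "strict_mono \<phi>" "\<And>n. kind (\<phi> n) = kind i0"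
    using infinite_enumerate[of "{i \<in> UNIV. kind i = kind i0}"] by auto
  define R h where "R = r i0" and "h = length (hs i0)"
  have R: "r (\<phi> n) = R" and h: "length (hs (\<phi> n)) = h" and empty: "ns (\<phi> n) = [] \<longleftrightarrow> ns i0 = []" for n
    using \<phi>(2)[of n] by (simp_all add: kind_def R_def h_def)
  have "finite (to_nat ` ({..1::nat} \<times> {..<R} \<times> {..<R} \<times> {us. set us \<subseteq> {..<k} \<and> length us \<le> Suc h}))"
    by (intro finite_imageI finite_cartesian_product finite_lists_length_le) auto
  then obtain M where "\<forall>m\<in>to_nat ` ({..1::nat} \<times> {..<R} \<times> {..<R} \<times> {us. set us \<subseteq> {..<k} \<and> length us \<le> Suc h}). m < M"
    unfolding finite_nat_set_iff_bounded by blast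
  then have M: "to_nat (tag, s, t, us) < M"
    if "tag \<le> (1::nat)" "s < R" "t < R" "set us \<subseteq> {..<k}" "length us \<le> Suc h" for tag s t us
    using that by auto
  define q where "q n = length (qs (\<phi> n))" for n
  define L where "L n = chain_letter (hs (\<phi> n)) (B (\<phi> n)) (X (\<phi> n)) (\<beta> (\<phi> n))" for n
  \<comment> \<open>The letter in front belongs to no matrix position; it ensures that the head data are present even if
    there are no matrix positions. The index 0 in it is a dummy.\<close>
  define a where "a n = map (L n) (0 # qs (\<phi> n))" for n
  define ps where "ps n = hs (\<phi> n) @ qs (\<phi> n)" for n
  have len_ps': "length (ps n) = h + q n" "length (ns (\<phi> n)) = h + q n" for n
    using len_ps[of "\<phi> n"] by (simp_all add: ps_def q_def h)
  have ps_less: "ps n ! b < h + q n" if "b < h + q n" for n b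
    using set_ps[of "\<phi> n"] len_ps'[of n] that nth_mem[of b "ps n"] unfolding ps_def by auto
  \<comment> \<open>The permutation \<open>ps n\<close> puts the head first, so \<open>E n\<close> also restores the original order of the factors.\<close>
  define E where "E n = substitution_map (replicate (h + q n) k) (ns (\<phi> n)) (\<lambda>b. ps n ! b)
      (\<lambda>b v. \<alpha> (\<phi> n) (ps n ! b) (unit_vector v))" for n
  have nat_E: "natural_map (replicate (h + q n) k) (ns (\<phi> n)) (E n)" for n
    unfolding E_def using ps_less[of _ n] len_ps'(2)[of n] by (intro natural_substitution_map) simp
  define C where "C j qs' = substitution_map (ns (\<phi> j)) (replicate (h + length qs') k)
      (\<lambda>a. if a \<in> set (hs (\<phi> j) @ qs') then list_index (hs (\<phi> j) @ qs') a else 0)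
      (\<lambda>a v. if a \<in> set (hs (\<phi> j) @ qs') then \<beta> (\<phi> j) a v else l (\<phi> j) a)" for j qs'
  have C_apply: "C j qs' (T (\<phi> j)) u = tensor_form (ns (\<phi> j)) (T (\<phi> j))
      (\<lambda>a. if a \<in> set (hs (\<phi> j) @ qs') then \<beta> (\<phi> j) a (u ! list_index (hs (\<phi> j) @ qs') a) else l (\<phi> j) a)"
    if "u \<in> tensor_positions (replicate (h + length qs') k)" for j qs' u
    unfolding C_def substitution_map_def using that by (simp add: if_distrib cong: if_cong)
  have C_chain: "C j qs' (T (\<phi> j)) = restrict (chain_tensor R h (length qs') c)
      (tensor_positions (replicate (h + length qs') k))"
    if "subseq qs' (qs (\<phi> j))" "c ! 0 = L j a0" "tl c = map (L j) qs'" "c \<noteq> []" for j qs' c a0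
  proof (rule ext)
    fix u
    show "C j qs' (T (\<phi> j)) u = restrict (chain_tensor R h (length qs') c)
      (tensor_positions (replicate (h + length qs') k)) u"
    proof (cases "u \<in> tensor_positions (replicate (h + length qs') k)")
      case True
      then have "length u = length (hs (\<phi> j) @ qs')"
        by (simp add: tensor_positions_replicate h)
      from normal_form_contraction[OF nf that(1) that(2,3)[unfolded L_def] that(4) this]
      show ?thesis
        unfolding C_apply[OF True] using True by (simp only: R h restrict_apply if_True)
    next
      case False
      then show ?thesis by (simp add: C_def substitution_map_def)
    qed
  qed
  define G where "G n c = g (\<phi> n) (E n (restrict (chain_tensor R h (q n) c)
      (tensor_positions (replicate (h + q n) k))))" for n c
  have "G n \<in> word_polys M (Suc (q n))" for n
    unfolding G_def[abs_def] using g(1)[of "\<phi> n"]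
  proof (rule poly_maps_substitution)
    fix w assume w: "w \<in> tensor_positions (ns (\<phi> n))"
    have "(\<lambda>c. E n (restrict (chain_tensor R h (q n) c) (tensor_positions (replicate (h + q n) k))) w) =
        (\<lambda>c. \<Sum>u\<in>tensor_positions (replicate (h + q n) k). chain_tensor R h (q n) c u *
          (\<Prod>b<h + q n. \<alpha> (\<phi> n) (ps n ! b) (unit_vector (w ! (ps n ! b))) (u ! b)))"
      using w unfolding E_def substitution_map_def tensor_form_def by (auto intro!: sum.cong)
    also have "\<dots> \<in> word_polys M (Suc (q n))"
      using M by (intro word_polys_sum word_polys_mult word_polys_const word_polys_chain_tensor)
    finally show "(\<lambda>c. E n (restrict (chain_tensor R h (q n) c)
        (tensor_positions (replicate (h + q n) k))) w) \<in> word_polys M (Suc (q n))" .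
  qed (intro word_polys_const word_polys_add word_polys_mult; assumption)+
  then have "\<forall>n. \<exists>G'. G' \<in> fspan (word_monom ` {u. shape M (Suc (q n)) u}) \<and>
      (\<forall>c. length c = Suc (q n) \<longrightarrow> G n c = G' c)"
    unfolding word_polys_def by blast
  then obtain G' where "\<forall>n. G' n \<in> fspan (word_monom ` {u. shape M (Suc (q n)) u}) \<and>
      (\<forall>c. length c = Suc (q n) \<longrightarrow> G n c = G' n c)"
    by (rule choice[THEN exE])
  then have G': "\<And>n. G' n \<in> fspan (word_monom ` {u. shape M (Suc (q n)) u})"
    "\<And>n c. length c = Suc (q n) \<Longrightarrow> G n c = G' n c"
    by blast+
  have len_a: "length (a n) = Suc (q n)" for n
    by (simp add: a_def q_def)
  \<comment> \<open>The expansion through \<open>\<alpha>\<close> and \<open>\<beta>\<close>, read as a composition of two natural maps.\<close>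
  have self: "E n (C n (qs (\<phi> n)) (T (\<phi> n))) = T (\<phi> n)" for n
  proof (rule extensionalityI[where A = "tensor_positions (ns (\<phi> n))"])
    show "E n (C n (qs (\<phi> n)) (T (\<phi> n))) \<in> extensional (tensor_positions (ns (\<phi> n)))"
      by (simp add: E_def substitution_map_def)
    show "T (\<phi> n) \<in> extensional (tensor_positions (ns (\<phi> n)))"
      using T[of "\<phi> n"] by (simp add: rank_approximation_def tensor_space_def PiE_def)
    fix w assume w: "w \<in> tensor_positions (ns (\<phi> n))"
    let ?y = "\<lambda>a. unit_vector (w ! a) :: nat \<Rightarrow> 'k"
    have dep: "tensor_form (ns (\<phi> n)) (T (\<phi> n)) (\<lambda>a. if a \<in> set (ps n) then z a else y a) =
        tensor_form (ns (\<phi> n)) (T (\<phi> n)) (\<lambda>a. if a \<in> set (ps n) then z a else y' a)" for z y y'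
      using set_ps[of "\<phi> n"] by (intro tensor_form_cong) (simp add: ps_def)
    have "T (\<phi> n) w = tensor_form (ns (\<phi> n)) (T (\<phi> n)) ?y"
      by (rule tensor_form_unit[OF w, symmetric])
    also have "\<dots> = (\<Sum>u\<in>tensor_positions (replicate (h + q n) k).
        (\<Prod>b<h + q n. \<alpha> (\<phi> n) (ps n ! b) (?y (ps n ! b)) (u ! b)) *
        tensor_form (ns (\<phi> n)) (T (\<phi> n))
          (\<lambda>a. if a \<in> set (ps n) then \<beta> (\<phi> n) a (u ! list_index (ps n) a) else ?y a))"
      using expansion[of "\<phi> n" ?y] unfolding ps_def[symmetric] len_ps' .
    also have "\<dots> = (\<Sum>u\<in>tensor_positions (replicate (h + q n) k). C n (qs (\<phi> n)) (T (\<phi> n)) u *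
        (\<Prod>b<h + q n. \<alpha> (\<phi> n) (ps n ! b) (?y (ps n ! b)) (u ! b)))"
    proof (intro sum.cong refl)
      fix u assume "u \<in> tensor_positions (replicate (h + q n) k)"
      then show "(\<Prod>b<h + q n. \<alpha> (\<phi> n) (ps n ! b) (?y (ps n ! b)) (u ! b)) *
          tensor_form (ns (\<phi> n)) (T (\<phi> n))
            (\<lambda>a. if a \<in> set (ps n) then \<beta> (\<phi> n) a (u ! list_index (ps n) a) else ?y a) =
          C n (qs (\<phi> n)) (T (\<phi> n)) u * (\<Prod>b<h + q n. \<alpha> (\<phi> n) (ps n ! b) (?y (ps n ! b)) (u ! b))"
        using C_apply[of u "qs (\<phi> n)" n]
          dep[of "\<lambda>a. \<beta> (\<phi> n) a (u ! list_index (ps n) a)" ?y "l (\<phi> n)"]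
        unfolding ps_def[symmetric] q_def[symmetric] by (simp only: mult.commute)
    qed
    also have "\<dots> = E n (C n (qs (\<phi> n)) (T (\<phi> n))) w"
      using w unfolding E_def substitution_map_def tensor_form_def by simp
    finally show "E n (C n (qs (\<phi> n)) (T (\<phi> n))) w = T (\<phi> n) w" by simp
  qed
  have "\<exists>i j b. i < j \<and> subseq b (a j) \<and> length b = length (a i) \<and> G' i b \<noteq> 0"
  proof (rule wide_matrix_noetherian)
    show "G' i \<in> fspan (word_monom ` {u. shape M (length (a i)) u})" for i
      using G'(1) len_a by simp
    fix i
    have "C i (qs (\<phi> i)) (T (\<phi> i)) = restrict (chain_tensor R h (length (qs (\<phi> i))) (a i))
      (tensor_positions (replicate (h + length (qs (\<phi> i))) k))"
      by (rule C_chain) (simp_all add: a_def)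
    then have "G i (a i) = g (\<phi> i) (T (\<phi> i))"
      unfolding G_def q_def using self[of i] by simp
    then show "G' i (a i) \<noteq> 0"
      using nz[of "\<phi> i"] G'(2)[OF len_a] by simp
  qed
  then obtain i j b where ij: "i < j" and b: "subseq b (a j)" "length b = length (a i)" "G' i b \<noteq> 0"
    by blast
  have "b \<noteq> []" using b(2) len_a by auto
  then obtain x b' where bx: "b = x # b'" by (cases b) auto
  have "x \<in> set (a j)" using subseq_set_subset[OF b(1)] bx by auto
  then obtain a0 where "x = L j a0" unfolding a_def by auto
  have "subseq b' (map (L j) (qs (\<phi> j)))"
    using b(1) unfolding bx a_def list.map by (metis subseq_Cons' subseq_Cons2_iff list_emb_Cons_iff2)
  then obtain N where "b' = nths (map (L j) (qs (\<phi> j))) N"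
    unfolding subseq_conv_nths by blast
  then have b': "b' = map (L j) (nths (qs (\<phi> j)) N)"
    by (simp add: nths_map)
  let ?qs' = "nths (qs (\<phi> j)) N"
  have sub: "subseq ?qs' (qs (\<phi> j))"
    unfolding subseq_conv_nths by blast
  have len: "length ?qs' = q i"
    using b(2) len_a[of i] unfolding bx b' by simp
  have "C j ?qs' (T (\<phi> j)) = restrict (chain_tensor R h (length ?qs') b)
      (tensor_positions (replicate (h + length ?qs') k))"
    using \<open>x = L j a0\<close> by (intro C_chain[OF sub]) (simp_all add: bx b')
  then have G_eq: "G i b = g (\<phi> i) (E i (C j ?qs' (T (\<phi> j))))"
    unfolding G_def using len by simp
  have nat_C: "natural_map (ns (\<phi> j)) (replicate (h + q i) k) (C j ?qs')"
    unfolding C_def len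
  proof (rule natural_substitution_map)
    fix c assume c: "c < length (ns (\<phi> j))"
    then have "ns (\<phi> i) \<noteq> []" using empty[of i] empty[of j] by auto
    then have "0 < h + q i" using len_ps'(2)[of i] by (metis length_greater_0_conv)
    moreover have "list_index (hs (\<phi> j) @ ?qs') c < h + q i" if "c \<in> set (hs (\<phi> j) @ ?qs')"
      using list_index_less[OF that] by (simp add: len h)
    ultimately show "(if c \<in> set (hs (\<phi> j) @ ?qs') then list_index (hs (\<phi> j) @ ?qs') c else 0) <
        length (replicate (h + q i) k)"
      by simp
  qed
  have "(\<lambda>S. g (\<phi> i) (E i (C j ?qs' S))) \<in> poly_maps (tensor_positions (ns (\<phi> j))) (e (\<phi> i))"
    using natural_map_poly_maps[OF nat_C natural_map_poly_maps[OF nat_E g(1)]] .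
  moreover have "vanishing k (ns (\<phi> j)) (\<lambda>S. g (\<phi> i) (E i (C j ?qs' S)))"
    using natural_map_vanishing[OF nat_C natural_map_vanishing[OF nat_E g(2)]] .
  moreover have "T (\<phi> j) \<in> rank_approximation k (e (\<phi> i)) (ns (\<phi> j))"
    using T_later ij \<phi>(1) by (simp add: strict_mono_less)
  ultimately have "g (\<phi> i) (E i (C j ?qs' (T (\<phi> j)))) = 0"
    unfolding rank_approximation_def by blast
  then show False
    using b(3) G'(2)[of b i] b(2) len_a[of i] G_eq by simp
qed

text \<open>
  If all \<open>d\<close> fail, pass to a sequence of degrees \<open>D i\<close> that increases so fast that the polynomial
  witnessing the failure at \<open>D i\<close> has degree at most \<open>D j\<close> for all \<open>j > i\<close>. It starts at \<open>k + 1\<close>, the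
  degree of the minors that bound the ranks of the flattenings.
\<close>

lemma rank_approximation_stabilizes:
  assumes inf: "infinite (UNIV :: 'k::field set)"
  shows "\<exists>d. \<forall>ns. \<forall>T \<in> rank_approximation k d ns. border_rank ns (T :: nat list \<Rightarrow> 'k) \<le> enat k"
proof (rule ccontr)
  assume "\<not> ?thesis"
  then have "\<forall>d. \<exists>ns. \<exists>T :: nat list \<Rightarrow> 'k. T \<in> rank_approximation k d ns \<and>
      (\<exists>f\<in>tensor_polys ns. vanishing k ns (mpoly_eval f) \<and> mpoly_eval f T \<noteq> 0)"
    unfolding border_rank_le_iff by blast
  then obtain ns where "\<forall>d. \<exists>T :: nat list \<Rightarrow> 'k. T \<in> rank_approximation k d (ns d) \<and>
      (\<exists>f\<in>tensor_polys (ns d). vanishing k (ns d) (mpoly_eval f) \<and> mpoly_eval f T \<noteq> 0)"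
    by (rule choice[THEN exE])
  then obtain T :: "nat \<Rightarrow> nat list \<Rightarrow> 'k" where "\<forall>d. T d \<in> rank_approximation k d (ns d) \<and>
      (\<exists>f\<in>tensor_polys (ns d). vanishing k (ns d) (mpoly_eval f) \<and> mpoly_eval f (T d) \<noteq> 0)"
    by (rule choice[THEN exE])
  then have T: "\<And>d. T d \<in> rank_approximation k d (ns d)"
    and "\<forall>d. \<exists>f. f \<in> tensor_polys (ns d) \<and> vanishing k (ns d) (mpoly_eval f) \<and> mpoly_eval f (T d) \<noteq> 0"
    by blast+
  from this(2) obtain f where "\<forall>d. f d \<in> tensor_polys (ns d) \<and> vanishing k (ns d) (mpoly_eval (f d)) \<and>
      mpoly_eval (f d) (T d) \<noteq> 0"
    by (rule choice[THEN exE])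
  then have f: "\<And>d. f d \<in> tensor_polys (ns d)" "\<And>d. vanishing k (ns d) (mpoly_eval (f d))"
    "\<And>d. mpoly_eval (f d) (T d) \<noteq> 0"
    by blast+
  define D where "D = rec_nat (Suc k) (\<lambda>_ d. max d (mpoly_degree (f d)))"
  have D_Suc: "D (Suc i) = max (D i) (mpoly_degree (f (D i)))" for i
    by (simp add: D_def)
  have D_mono: "mono D"
    by (simp add: mono_iff_le_Suc D_Suc)
  have D_ge: "Suc k \<le> D i" for i
    using monoD[OF D_mono, of 0 i] by (simp add: D_def)
  have D_deg: "mpoly_degree (f (D i)) \<le> D j" if "i < j" for i j
    using monoD[OF D_mono, of "Suc i" j] that by (simp add: D_Suc)
  show False
  proof (rule no_bad_sequence[OF inf, of "\<lambda>i. T (D i)" k "\<lambda>i. ns (D i)"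
        "\<lambda>i. mpoly_degree (f (D i))" "\<lambda>i. mpoly_eval (f (D i))"])
    show "T (D i) \<in> rank_approximation k (Suc k) (ns (D i))" for i
      using T rank_approximation_antimono[OF D_ge] by blast
    show "T (D j) \<in> rank_approximation k (mpoly_degree (f (D i))) (ns (D j))" if "i < j" for i j
      using T rank_approximation_antimono[OF D_deg[OF that]] by blast
    show "mpoly_eval (f (D i)) \<in> poly_maps (tensor_positions (ns (D i))) (mpoly_degree (f (D i)))" for i
      using f(1)[of "D i"] by (intro mpoly_eval_in_poly_maps) (auto simp: tensor_polys_def)
  qed (rule f)+
qed

theorem theorem1p2:
  fixes k :: nat
  assumes "infinite (UNIV :: 'k::field set)"
  shows "\<exists>d::nat. \<forall>ns :: nat list.
           \<exists>F \<subseteq> (tensor_polys ns :: (nat list, 'k) mpolynomial set).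
             (\<forall>f\<in>F. mpoly_degree f \<le> d) \<and>
             {\<omega> \<in> tensor_space ns. border_rank ns \<omega> \<le> enat k} =
             {\<omega> \<in> tensor_space ns. \<forall>f\<in>F. mpoly_eval f \<omega> = 0}"
proof -
  obtain d where d: "\<And>ns (T :: nat list \<Rightarrow> 'k). T \<in> rank_approximation k d ns \<Longrightarrow> border_rank ns T \<le> enat k"
    using rank_approximation_stabilizes[OF assms] by blast
  show ?thesis
  proof (intro exI[of _ d] allI)
    fix ns :: "nat list"
    let ?F = "{f \<in> tensor_polys ns. mpoly_degree f \<le> d \<and> vanishing k ns (mpoly_eval f)} ::
      (nat list, 'k) mpolynomial set"
    have "border_rank ns \<omega> \<le> enat k \<longleftrightarrow> (\<forall>f\<in>?F. mpoly_eval f \<omega> = 0)"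
      if \<omega>: "\<omega> \<in> tensor_space ns" for \<omega>
    proof
      assume "border_rank ns \<omega> \<le> enat k"
      then show "\<forall>f\<in>?F. mpoly_eval f \<omega> = 0"
        unfolding border_rank_le_iff by blast
    next
      assume zero: "\<forall>f\<in>?F. mpoly_eval f \<omega> = 0"
      have "g \<omega> = 0" if g: "g \<in> poly_maps (tensor_positions ns) d" "vanishing k ns g" for g
      proof -
        obtain f where "\<forall>m\<in>Poly_Mapping.keys f. Poly_Mapping.keys m \<subseteq> tensor_positions ns"
          "mpoly_degree f \<le> d" "mpoly_eval f = g"
          using poly_maps_imp_mpoly[OF g(1)] by blast
        then have "f \<in> ?F" "mpoly_eval f = g"
          using g(2) by (simp_all add: tensor_polys_def)
        then show ?thesis using zero by blast
      qed
      then have "\<omega> \<in> rank_approximation k d ns"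
        using \<omega> by (simp add: rank_approximation_def)
      then show "border_rank ns \<omega> \<le> enat k" by (rule d)
    qed
    then show "\<exists>F \<subseteq> (tensor_polys ns :: (nat list, 'k) mpolynomial set).
             (\<forall>f\<in>F. mpoly_degree f \<le> d) \<and>
             {\<omega> \<in> tensor_space ns. border_rank ns \<omega> \<le> enat k} =
             {\<omega> \<in> tensor_space ns. \<forall>f\<in>F. mpoly_eval f \<omega> = 0}"
      by (intro exI[of _ ?F]) auto
  qed
qed

end
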